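(* Let $\mathrm{Im}\,\tau>0$ and $z\in\mathbb{C}-(\mathbb{Z}+\tau\mathbb{Z})$. Then \[ \Gamma(z,\tau,\tau)=\frac{e^{-\pi iQ(z;\tau,\tau)}}{\theta_0\left(\frac z\tau,-\frac1\tau\right)}\prod_{k=0}^\infty\frac{\psi\left(\frac{k+1+z}\tau\right)}{\psi\left(\frac{k-z}\tau\right)}. \]
   Context: For $\mathrm{Im}\,\tau,\mathrm{Im}\,\sigma>0$, \[ \Gamma(z,\tau,\sigma)=\prod_{j,k=0}^\infty\frac{1-e^{2\pi i((j+1)\tau+(k+1)\sigma-z)}}{1-e^{2\pi i(j\tau+k\sigma+z)}},\qquad \theta_0(z,\tau)=\prod_{j=0}^\infty(1-e^{2\pi i((j+1)\tau-z)})(1-e^{2\pi i(j\tau+z)}). \] \[ Q(z;\tau,\sigma)=\frac{z^3}{3\tau\sigma}-\frac{\tau+\sigma-1}{2\tau\sigma}z^2+\frac{\tau^2+\sigma^2+3\tau\sigma-3\tau-3\sigma+1}{6\tau\sigma}z+\frac1{12}(\tau+\sigma-1)(\tau^{-1}+\sigma^{-1}-1). \] With $\mathrm{Li}_2(x)=\sum_{j\ge1}x^j/j^2$, $\psi$ is defined for $\mathrm{Im}\,t<0$ by \[ \psi(t)=\exp\left(t\ln(1-e^{-2\pi it})-\frac1{2\pi i}\mathrm{Li}_2(e^{-2\pi it})\right),\qquad \ln(1-x)=-\sum_{j\ge1}x^j/j\ \ (|x|<1), \] and on $\mathbb{C}$ by analytic continuation to a meromorphic function. (It has a zero of order $n$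 at $t=n$ and a pole of order $n$ at $t=-n$ for $n=1,2,\dots$, and no other zeros or poles.) *)

theory Defs
  imports "HOL-Complex_Analysis.Complex_Analysis"
begin

text \<open>
  The double product converges absolutely for \<open>Im \<tau>, Im \<sigma> > 0\<close> and \<open>z\<close> not a pole, so taking it
  as an iterated product is no restriction.  At a pole of the meromorphic function some
  denominator vanishes and the value below is \<open>0\<close>, because \<open>x / 0 = 0\<close>.
\<close>

definition ell_Gamma :: "complex \<Rightarrow> complex \<Rightarrow> complex \<Rightarrow> complex" where
  "ell_Gamma z \<tau> \<sigma> =
     (\<Prod>j. \<Prod>k.
        (1 - exp (2 * of_real pi * \<i> * ((of_nat j + 1) * \<tau> + (of_nat k + 1) * \<sigma> - z))) /
        (1 - exp (2 * of_real pi * \<i> * (of_nat j * \<tau> + of_nat k * \<sigma> + z))))"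

definition theta0 :: "complex \<Rightarrow> complex \<Rightarrow> complex" where
  "theta0 z \<tau> =
     (\<Prod>j. (1 - exp (2 * of_real pi * \<i> * ((of_nat j + 1) * \<tau> - z))) *
           (1 - exp (2 * of_real pi * \<i> * (of_nat j * \<tau> + z))))"

definition Q :: "complex \<Rightarrow> complex \<Rightarrow> complex \<Rightarrow> complex" where
  "Q z \<tau> \<sigma> =
     z ^ 3 / (3 * \<tau> * \<sigma>)
     - (\<tau> + \<sigma> - 1) / (2 * \<tau> * \<sigma>) * z ^ 2
     + (\<tau> ^ 2 + \<sigma> ^ 2 + 3 * \<tau> * \<sigma> - 3 * \<tau> - 3 * \<sigma> + 1) / (6 * \<tau> * \<sigma>) * z
     + 1 / 12 * (\<tau> + \<sigma> - 1) * (inverse \<tau> + inverse \<sigma> - 1)"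

text \<open>The two series below are used only for \<open>norm x < 1\<close>.\<close>

definition Li2 :: "complex \<Rightarrow> complex" where
  "Li2 x = (\<Sum>j. x ^ Suc j / of_nat (Suc j) ^ 2)"

definition ln_one_minus :: "complex \<Rightarrow> complex" where
  "ln_one_minus x = - (\<Sum>j. x ^ Suc j / of_nat (Suc j))"

definition psi_lower :: "complex \<Rightarrow> complex" where
  "psi_lower t =
     exp (t * ln_one_minus (exp (- (2 * of_real pi * \<i> * t)))
          - 1 / (2 * of_real pi * \<i>) * Li2 (exp (- (2 * of_real pi * \<i> * t))))"

text \<open>
  The meromorphic continuation to the whole plane.  Requiring a nicely meromorphic function
  (continuous away from its poles, with value \<open>0\<close> at them) determines the continuation as a
  total function, by the identity theorem.
\<close>

definition psi :: "complex \<Rightarrow> complex" where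
  "psi = (THE f. f nicely_meromorphic_on UNIV \<and> (\<forall>t. Im t < 0 \<longrightarrow> f t = psi_lower t))"

end

theory Submission
  imports Defs "HOL-Real_Asymp.Real_Asymp"
begin

text \<open>
  Both sides of the identity are compared as functions of \<open>z\<close> for fixed \<open>\<tau>\<close>, by means of their
  behaviour under \<open>z \<mapsto> z + 1\<close> and \<open>z \<mapsto> z + \<tau>\<close> and the maximum modulus principle.

  The logarithmic derivative of \<open>\<psi>\<close> is \<open>2 \<pi> \<i> t / (e(t) - 1)\<close> with \<open>e(t) = exp(2 \<pi> \<i> t)\<close>; hence
  \<open>\<psi>(t + 1) = (1 - e(-t)) \<psi>(t)\<close> and \<open>\<psi>(t) \<psi>(-t) = e(1/12 - t\<^sup>2/2)\<close>, the constant coming from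
  \<open>Li\<^sub>2(1) = \<pi>\<^sup>2/6\<close>.  Writing \<open>P(z)\<close> for the infinite product over \<open>k\<close>, a telescoping argument
  turns the reflection formula into a formula for \<open>P(z + 1) / P(z)\<close>, and the shift formula gives
  \<open>P(z + \<tau>) = P(z) \<theta>\<^sub>0(z/\<tau>, -1/\<tau>)\<close>.  Moreover \<open>P(0) = 1 / \<psi>(0)\<close> telescopes.

  Because of the last shift formula the theorem is equivalent to
  \<open>\<Gamma>(z + \<tau>, \<tau>, \<tau>) = exp(-\<pi> \<i> Q(z + \<tau>)) P(z)\<close>, that is, to \<open>H = 1\<close> for the quotient \<open>H\<close> of the
  right-hand side by the left-hand side.  On the open parallelogram
  \<open>{a + b \<tau> : \<bar>a\<bar>, \<bar>b\<bar> < 1}\<close> (\<open>period_cell\<close>) this quotient is holomorphic, since there the arguments avoid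
  all zeros and poles of \<open>\<psi>\<close> and of the elliptic gamma function.  One has \<open>H(z + 1) = H(z)\<close> and
  \<open>H(z + \<tau>) = M(z) H(z)\<close>, where \<open>M\<close> is the quotient of the two sides of the modular transformation
  of \<open>\<theta>\<^sub>0\<close> (\<open>theta_quotient\<close>).

  A holomorphic function on the parallelogram whose modulus is invariant under the two periods is
  constant: every value of the modulus is attained on the compact half-size parallelogram, so the
  maximum is attained in the interior (\<open>periodic_norm_imp_constant\<close>).  This shows that \<open>M\<close> is a constant
  \<open>c\<close>, and multiplying its values at three half periods gives \<open>c\<^sup>3 = 1\<close> by Euler's identity
  \<open>(\<Prod>n\<ge>1. (1 + q\<^sup>n) (1 - q\<^sup>2\<^sup>n\<^sup>-\<^sup>1)) = 1\<close> (\<open>theta0_half_periods\<close>).  In particular \<open>\<bar>c\<bar> = 1\<close>, so the same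
  criterion applies to \<open>H\<close>; it is constant with \<open>H(0) = 1\<close>, and then \<open>c = 1\<close> as well.  The shift formulas
  carry the identity from the parallelogram to all \<open>z\<close> outside the lattice.
\<close>

section \<open>The normalised exponential function\<close>

text \<open>The exponential with period \<open>1\<close>, usually written \<open>e(z)\<close>.\<close>

definition e1 :: "complex \<Rightarrow> complex" where
  "e1 z = exp (2 * of_real pi * \<i> * z)"

lemma e1_add: "e1 (a + b) = e1 a * e1 b"
  by (simp add: e1_def ring_distribs exp_add)

lemma e1_minus: "e1 (- a) = inverse (e1 a)"
  by (simp add: e1_def exp_minus)

lemma e1_diff: "e1 (a - b) = e1 a / e1 b"
  by (simp add: e1_def right_diff_distrib exp_diff)

lemma e1_nonzero [simp]: "e1 a \<noteq> 0"
  by (simp add: e1_def)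

lemma e1_0 [simp]: "e1 0 = 1"
  by (simp add: e1_def)

lemma e1_eq_1_iff: "e1 z = 1 \<longleftrightarrow> z \<in> \<int>"
proof
  assume "e1 z = 1"
  then obtain n :: int where "Re (2 * of_real pi * \<i> * z) = 0" 
    "Im (2 * of_real pi * \<i> * z) = of_int (2 * n) * pi"
    unfolding e1_def exp_eq_1 by auto
  then have "z = of_int n"
    by (simp add: complex_eq_iff)
  then show "z \<in> \<int>" by simp
next
  assume "z \<in> \<int>"
  then obtain n :: int where "z = of_int n" by (auto elim: Ints_cases)
  then show "e1 z = 1"
    by (auto simp: e1_def exp_eq_1 intro!: exI[of _ n])
qed

lemma e1_of_int [simp]: "e1 (of_int n) = 1"
  by (simp add: e1_eq_1_iff)

lemma e1_of_nat [simp]: "e1 (of_nat n) = 1"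
  by (simp add: e1_eq_1_iff)

lemma e1_1 [simp]: "e1 1 = 1"
  by (simp add: e1_eq_1_iff)

lemma norm_e1: "norm (e1 z) = exp (- 2 * pi * Im z)"
  by (simp add: e1_def)

lemma norm_e1_less_1: "Im z > 0 \<Longrightarrow> norm (e1 z) < 1"
  by (simp add: norm_e1)

lemma e1_power: "e1 z ^ n = e1 (of_nat n * z)"
  by (simp add: e1_def exp_of_nat_mult [symmetric] mult_ac)

lemma DERIV_e1 [derivative_intros]:
  "(f has_field_derivative f') (at x within S) \<Longrightarrow>
    ((\<lambda>x. e1 (f x)) has_field_derivative e1 (f x) * (2 * of_real pi * \<i> * f')) (at x within S)"
  unfolding e1_def by (auto intro!: derivative_eq_intros)

lemma holomorphic_on_e1 [holomorphic_intros]: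
  "f holomorphic_on S \<Longrightarrow> (\<lambda>x. e1 (f x)) holomorphic_on S"
  unfolding e1_def by (intro holomorphic_intros)

lemma tendsto_e1_minus_1: "((\<lambda>w. (e1 w - 1) / w) \<longlongrightarrow> 2 * of_real pi * \<i>) (at 0)"
proof -
  have "(e1 has_field_derivative (2 * of_real pi * \<i>)) (at 0)"
    using DERIV_e1[OF DERIV_ident, of 0 UNIV] by simp
  then show ?thesis
    by (simp add: has_field_derivative_iff)
qed

section \<open>The logarithmic and dilogarithmic series\<close>

lemma ln_one_minus_eq: "norm x < 1 \<Longrightarrow> ln_one_minus x = ln (1 - x)"
proof -
  assume "norm x < 1"
  from Ln_series'[of "- x"] this have "(\<lambda>n. - (x ^ n) / of_nat n) sums ln (1 - x)"
    by simp
  then have "(\<lambda>n. - (x ^ Suc n) / of_nat (Suc n)) sums ln (1 - x)"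
    by (subst sums_Suc_iff) simp
  then have "(\<lambda>n. - (- (x ^ Suc n) / of_nat (Suc n))) sums (- ln (1 - x))"
    by (rule sums_minus)
  then show ?thesis
    unfolding ln_one_minus_def by (simp add: sums_iff del: of_nat_Suc)
qed

lemma DERIV_Li2:
  assumes "norm x < 1" "x \<noteq> 0"
  shows "(Li2 has_field_derivative (- ln (1 - x) / x)) (at x)"
proof -
  define c :: "nat \<Rightarrow> complex" where "c = (\<lambda>n. 1 / of_nat n ^ 2)"
  have sm: "summable (\<lambda>n. c n * y ^ n)" if "norm y < 1" for y
  proof (rule summable_comparison_test)
    show "\<exists>N. \<forall>n\<ge>N. norm (c n * y ^ n) \<le> norm y ^ n"
    proof (intro exI[of _ 0] allI impI)
      fix n
      have "norm (c n) \<le> 1"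
        by (cases n) (auto simp: c_def norm_divide norm_power divide_simps simp del: of_nat_Suc)
      then show "norm (c n * y ^ n) \<le> norm y ^ n"
        by (simp add: norm_mult norm_power mult_left_le_one_le)
    qed
  qed (use that in simp)
  have Li2_eq: "Li2 y = (\<Sum>n. c n * y ^ n)" if "norm y < 1" for y
  proof -
    have "(\<Sum>n. c (Suc n) * y ^ Suc n) = (\<Sum>n. c n * y ^ n)"
      using suminf_split_head[OF sm[OF that]] by (simp add: c_def)
    then show ?thesis by (simp add: Li2_def c_def mult.commute)
  qed
  have "((\<lambda>y. \<Sum>n. c n * y ^ n) has_field_derivative (\<Sum>n. diffs c n * x ^ n)) (at x)"
    using termdiffs_strong'[of 1 c x] sm assms by auto
  then have D: "(Li2 has_field_derivative (\<Sum>n. diffs c n * x ^ n)) (at x)"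
    by (rule has_field_derivative_transform_within_open[of _ _ _ "ball 0 1"])
       (use assms Li2_eq in auto)
  have "diffs c n = 1 / of_nat (Suc n)" for n
    by (simp add: diffs_def c_def power2_eq_square del: of_nat_Suc)
  then have "x * (\<Sum>n. diffs c n * x ^ n) = (\<Sum>n. x ^ Suc n / of_nat (Suc n))"
    using suminf_mult[OF termdiff_converges[of x 1 c], of x] assms sm
    by (simp add: mult_ac del: of_nat_Suc)
  also have "\<dots> = - ln (1 - x)"
    using ln_one_minus_eq[OF assms(1)] unfolding ln_one_minus_def by (metis minus_minus)
  finally have "(\<Sum>n. diffs c n * x ^ n) = - ln (1 - x) / x"
    by (metis assms(2) nonzero_mult_div_cancel_left)
  with D show ?thesis by simp
qed

text \<open>A common bound for the series of \<open>ln (1 - x)\<close> and \<open>Li\<^sub>2(x)\<close> near \<open>x = 0\<close>.\<close>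

lemma norm_series_le:
  fixes c :: "nat \<Rightarrow> complex"
  assumes "norm x \<le> 1 / 2" "\<And>j. norm (c j) \<le> 1"
  shows "norm (\<Sum>j. x ^ Suc j * c j) \<le> 2 * norm x"
proof -
  have "norm (x ^ Suc j * c j) \<le> norm x * (1 / 2) ^ j" for j
  proof -
    have "norm (x ^ Suc j * c j) \<le> norm x ^ Suc j * 1"
      unfolding norm_mult norm_power by (intro mult_mono assms) auto
    also have "\<dots> \<le> norm x * (1 / 2) ^ j"
      using assms by (auto intro!: mult_left_mono power_mono)
    finally show ?thesis .
  qed
  moreover have "(\<lambda>j. norm x * (1 / 2) ^ j) sums (norm x * 2)"
    using geometric_sums[of "1/2 :: real"] by (intro sums_mult) simp
  ultimately show ?thesis
    using norm_suminf_le[of "\<lambda>j. x ^ Suc j * c j" "\<lambda>j. norm x * (1 / 2) ^ j"]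
    by (simp add: sums_iff)
qed

lemma norm_ln_one_minus_le: "norm x \<le> 1 / 2 \<Longrightarrow> norm (ln_one_minus x) \<le> 2 * norm x"
  using norm_series_le[of x "\<lambda>j. 1 / of_nat (Suc j)"]
  by (simp add: ln_one_minus_def norm_divide del: of_nat_Suc)

lemma norm_Li2_le:
  assumes "norm x \<le> 1 / 2"
  shows "norm (Li2 x) \<le> 2 * norm x"
proof -
  have "norm (1 / of_nat (Suc j) ^ 2 :: complex) \<le> 1" for j
    by (simp add: norm_divide norm_power one_le_power divide_le_eq_1 del: of_nat_Suc)
  from norm_series_le[OF assms this] show ?thesis
    by (simp add: Li2_def del: of_nat_Suc)
qed

lemma continuous_on_Li2: "continuous_on (cball 0 1) Li2"
proof -
  have "uniform_limit (cball 0 1) (\<lambda>n x. \<Sum>j<n. x ^ Suc j / of_nat (Suc j) ^ 2)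
          (\<lambda>x::complex. \<Sum>j. x ^ Suc j / of_nat (Suc j) ^ 2) sequentially"
  proof (rule Weierstrass_m_test)
    fix n and x :: complex
    assume "x \<in> cball 0 1"
    then have "norm x ^ Suc n \<le> 1" by (intro power_le_one) auto
    then show "norm (x ^ Suc n / of_nat (Suc n) ^ 2) \<le> 1 / real (Suc n) ^ 2"
      unfolding norm_divide norm_power by (simp add: divide_right_mono del: of_nat_Suc power_Suc)
  next
    show "summable (\<lambda>n. 1 / real (Suc n) ^ 2)"
      using inverse_squares_sums by (simp add: sums_iff add.commute)
  qed
  then show ?thesis
    unfolding Li2_def [abs_def]
    by (rule uniform_limit_theorem[rotated]) (auto intro!: continuous_intros always_eventually simp del: of_nat_Suc)
qed

lemma Li2_1: "Li2 1 = of_real (pi ^ 2 / 6)"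
proof -
  have "(\<lambda>n. complex_of_real (1 / (real n + 1) ^ 2)) sums of_real (pi ^ 2 / 6)"
    using inverse_squares_sums by (intro sums_of_real) (simp add: add.commute)
  then show ?thesis
    by (simp add: Li2_def sums_iff add.commute)
qed

section \<open>The function psi on a vertical strip\<close>

text \<open>The logarithmic derivative of \<open>\<psi>\<close>, with its removable singularity at \<open>0\<close> filled in.\<close>

definition psi_dlog :: "complex \<Rightarrow> complex" where
  "psi_dlog t = (if t = 0 then 1 else 2 * of_real pi * \<i> * t / (e1 t - 1))"

text \<open>A convex neighbourhood of the imaginary axis on which \<open>\<psi>\<close> has neither zeros nor poles.\<close>

definition unit_strip :: "complex set" where
  "unit_strip = {t. \<bar>Re t\<bar> < 1}"

lemma open_unit_strip: "open unit_strip"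
  unfolding unit_strip_def by (intro open_Collect_less continuous_intros)

lemma convex_unit_strip: "convex unit_strip"
proof -
  have *: "unit_strip = {t. Re t < 1} \<inter> {t. Re t > - 1}"
    by (auto simp: unit_strip_def)
  show ?thesis
    unfolding * by (intro convex_Int convex_halfspace_Re_lt convex_halfspace_Re_gt)
qed

lemma unit_strip_Int_Ints: "t \<in> unit_strip \<Longrightarrow> t \<in> \<int> \<Longrightarrow> t = 0"
  by (auto simp: unit_strip_def elim!: Ints_cases)

lemma holomorphic_psi_dlog: "psi_dlog holomorphic_on unit_strip"
proof -
  have "(\<lambda>t. if t = 0 then 1 else 2 * of_real pi * \<i> * t / (e1 t - 1)) holomorphic_on unit_strip"
  proof (rule removable_singularity)
    show "(\<lambda>t. 2 * of_real pi * \<i> * t / (e1 t - 1)) holomorphic_on unit_strip - {0}"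
      by (intro holomorphic_intros) (auto simp: e1_eq_1_iff dest: unit_strip_Int_Ints)
    have "((\<lambda>t. 2 * of_real pi * \<i> / ((e1 t - 1) / t)) \<longlongrightarrow> 
            2 * of_real pi * \<i> / (2 * of_real pi * \<i>)) (at 0)"
      by (intro tendsto_divide tendsto_const tendsto_e1_minus_1) simp
    then show "(\<lambda>t. 2 * of_real pi * \<i> * t / (e1 t - 1)) \<midarrow>0\<rightarrow> 1"
      by simp
  qed (rule open_unit_strip)
  then show ?thesis
    unfolding psi_dlog_def [abs_def] .
qed

text \<open>The branch of \<open>\<psi>\<close> on the strip: the solution of \<open>f' = f \<cdot> psi_dlog\<close> with \<open>f(0) = e(1/24)\<close>.  The initial
  value is the limit of the given formula at \<open>0\<close>, so that this function continues \<open>psi_lower\<close>.\<close>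

definition psi_strip :: "complex \<Rightarrow> complex" where
  "psi_strip t = e1 (1 / 24) * exp (contour_integral (linepath 0 t) psi_dlog)"

lemma psi_strip_0 [simp]: "psi_strip 0 = e1 (1 / 24)"
  by (simp add: psi_strip_def)

lemma psi_strip_nonzero [simp]: "psi_strip t \<noteq> 0"
  by (simp add: psi_strip_def)

lemma DERIV_psi_strip:
  assumes "t \<in> unit_strip"
  shows "(psi_strip has_field_derivative psi_strip t * psi_dlog t) (at t)"
proof -
  obtain G where G: "\<And>x. x \<in> unit_strip \<Longrightarrow> (G has_field_derivative psi_dlog x) (at x within unit_strip)"
    using holomorphic_convex_primitive'[OF convex_unit_strip open_unit_strip holomorphic_psi_dlog] by blast
  have eq: "contour_integral (linepath 0 x) psi_dlog = G x - G 0" if "x \<in> unit_strip" for x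
  proof -
    have "closed_segment 0 x \<subseteq> unit_strip"
      using that by (intro closed_segment_subset convex_unit_strip) (auto simp: unit_strip_def)
    then show ?thesis
      using contour_integral_primitive[of unit_strip G psi_dlog "linepath 0 x"] G
      by (intro contour_integral_unique) auto
  qed
  have "((\<lambda>x. e1 (1 / 24) * exp (G x - G 0)) has_field_derivative
          e1 (1 / 24) * exp (G t - G 0) * psi_dlog t) (at t)"
  proof -
    have G': "((\<lambda>x. G x - G 0) has_field_derivative psi_dlog t) (at t)"
      using DERIV_diff[OF G[OF assms] DERIV_const[of "G 0"]] at_within_open[OF assms open_unit_strip] by simp
    show ?thesis
      using DERIV_cmult[OF DERIV_chain'[OF G' DERIV_exp], of "e1 (1 / 24)"] by (simp add: mult_ac)
  qed
  then have "(psi_strip has_field_derivative e1 (1 / 24) * exp (G t - G 0) * psi_dlog t) (at t)"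
    by (rule has_field_derivative_transform_within_open[OF _ open_unit_strip assms])
       (simp add: psi_strip_def eq)
  then show ?thesis
    by (simp add: psi_strip_def eq assms)
qed

lemma holomorphic_psi_strip: "psi_strip holomorphic_on unit_strip"
  unfolding holomorphic_on_open[OF open_unit_strip] using DERIV_psi_strip by blast

lemma psi_strip_reflect:
  assumes "t \<in> unit_strip"
  shows "psi_strip t * psi_strip (- t) = e1 (1 / 12 - t ^ 2 / 2)"
proof -
  define f where "f = (\<lambda>t. psi_strip t * psi_strip (- t) * e1 (t ^ 2 / 2))"
  have "(f has_field_derivative 0) (at x within unit_strip)" if x: "x \<in> unit_strip" for x
  proof -
    have x': "- x \<in> unit_strip" using x by (simp add: unit_strip_def)
    have "psi_dlog x - psi_dlog (- x) + 2 * of_real pi * \<i> * x = 0"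
    proof (cases "x = 0")
      case False
      then have "e1 x \<noteq> 1"
        using x unit_strip_Int_Ints by (auto simp: e1_eq_1_iff)
      then have ne: "e1 x - 1 \<noteq> 0" by simp
      have eq: "e1 (- x) - 1 = - ((e1 x - 1) / e1 x)"
        by (simp add: e1_minus field_simps)
      have "psi_dlog (- x) = 2 * of_real pi * \<i> * x * e1 x / (e1 x - 1)"
        unfolding psi_dlog_def eq using False by simp
      then have "psi_dlog x - psi_dlog (- x) = 2 * of_real pi * \<i> * x * ((1 - e1 x) / (e1 x - 1))"
        using False by (simp add: psi_dlog_def right_diff_distrib diff_divide_distrib)
      also have "(1 - e1 x) / (e1 x - 1) = - 1"
        using ne by (simp add: divide_eq_eq)
      finally show ?thesis by simp
    qed (simp add: psi_dlog_def)
    then have *: "psi_dlog x + 2 * of_real pi * \<i> * x = psi_dlog (- x)"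
      by (simp add: algebra_simps)
    have D1: "((\<lambda>y. psi_strip (- y)) has_field_derivative - (psi_strip (- x) * psi_dlog (- x))) (at x)"
      using DERIV_chain'[OF DERIV_minus[OF DERIV_ident] DERIV_psi_strip[OF x']] by simp
    have D2: "((\<lambda>y. e1 (y ^ 2 / 2)) has_field_derivative e1 (x ^ 2 / 2) * (2 * of_real pi * \<i> * x)) (at x)"
      by (auto intro!: derivative_eq_intros)
    have "(f has_field_derivative
        (psi_strip x * psi_dlog x * psi_strip (- x) 
          - psi_strip (- x) * psi_dlog (- x) * psi_strip x) * e1 (x ^ 2 / 2)
        + e1 (x ^ 2 / 2) * (2 * of_real pi * \<i> * x) * (psi_strip x * psi_strip (- x))) (at x)"
      unfolding f_def
      by (rule DERIV_cong[OF DERIV_mult'[OF DERIV_mult'[OF DERIV_psi_strip[OF x] D1] D2]])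
        (simp add: algebra_simps)
    also have "(psi_strip x * psi_dlog x * psi_strip (- x) 
          - psi_strip (- x) * psi_dlog (- x) * psi_strip x) * e1 (x ^ 2 / 2)
        + e1 (x ^ 2 / 2) * (2 * of_real pi * \<i> * x) * (psi_strip x * psi_strip (- x)) = 0"
      unfolding * [symmetric] by (simp add: algebra_simps)
    finally show ?thesis by (rule has_field_derivative_at_within)
  qed
  with has_field_derivative_zero_constant[OF convex_unit_strip, of f]
  obtain c where "\<And>x. x \<in> unit_strip \<Longrightarrow> f x = c" by auto
  from this[OF assms] this[of 0] have "f t = f 0" by (simp add: unit_strip_def)
  then show ?thesis
    unfolding f_def e1_diff by (simp add: eq_divide_eq flip: e1_add)
qed

lemma DERIV_psi_lower:
  assumes "Im t < 0"
  shows "(psi_lower has_field_derivative psi_lower t * psi_dlog t) (at t)"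
proof -
  have e1_lt: "norm (e1 (- x)) < 1" if "Im x < 0" for x
    using that by (intro norm_e1_less_1) simp
  define h where "h = (\<lambda>x. x * ln (1 - e1 (- x)) - 1 / (2 * of_real pi * \<i>) * Li2 (e1 (- x)))"
  have psi_lower_eq: "psi_lower x = exp (h x)" if "Im x < 0" for x
    using ln_one_minus_eq[OF e1_lt[OF that]] by (simp add: psi_lower_def h_def e1_def)
  define q where "q = e1 (- t)"
  have q: "q \<noteq> 0" "norm q < 1" "e1 t = 1 / q" 
    using e1_lt[OF assms] by (auto simp: q_def e1_minus divide_inverse)
  have "1 - q \<notin> \<real>\<^sub>\<le>\<^sub>0"
    using q(2) complex_Re_le_cmod[of q] by (auto simp: complex_nonpos_Reals_iff)
  then have D: "((\<lambda>x. ln (1 - e1 (- x))) has_field_derivative (2 * of_real pi * \<i> * q / (1 - q))) (at t)"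
    unfolding q_def by (auto intro!: derivative_eq_intros simp: field_simps)
  have D2: "((\<lambda>x. Li2 (e1 (- x))) has_field_derivative (2 * of_real pi * \<i> * ln (1 - q))) (at t)"
    using DERIV_chain'[OF DERIV_e1[OF DERIV_minus[OF DERIV_ident]] DERIV_Li2[of "e1 (- t)"]] q
    unfolding q_def by (simp add: mult_ac)
  have "(h has_field_derivative (ln (1 - q) + t * (2 * of_real pi * \<i> * q / (1 - q))
          - 1 / (2 * of_real pi * \<i>) * (2 * of_real pi * \<i> * ln (1 - q)))) (at t)"
    unfolding h_def
    by (rule DERIV_cong[OF DERIV_diff[OF DERIV_mult'[OF DERIV_ident D] DERIV_cmult[OF D2]]])
      (simp add: q_def algebra_simps)
  also have "ln (1 - q) + t * (2 * of_real pi * \<i> * q / (1 - q))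
      - 1 / (2 * of_real pi * \<i>) * (2 * of_real pi * \<i> * ln (1 - q)) = psi_dlog t"
  proof -
    have "t \<noteq> 0" "q \<noteq> 1" using assms q(2) by auto
    moreover have "e1 t - 1 = (1 - q) / q" using q by (simp add: diff_divide_distrib)
    ultimately have "psi_dlog t = t * (2 * of_real pi * \<i> * q / (1 - q))"
      by (simp add: psi_dlog_def)
    then show ?thesis by simp
  qed
  finally have "((\<lambda>x. exp (h x)) has_field_derivative psi_lower t * psi_dlog t) (at t)"
    by (auto intro!: derivative_eq_intros simp: psi_lower_eq assms)
  then show ?thesis
    by (rule has_field_derivative_transform_within_open[of _ _ _ "{x. Im x < 0}"])
       (use assms psi_lower_eq in \<open>auto simp: open_halfspace_Im_lt\<close>)
qed

text \<open>Along the negative imaginary axis the logarithmic term dies out and \<open>Li\<^sub>2\<close> tends to \<open>\<pi>\<^sup>2/6\<close>.\<close>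

lemma psi_lower_tendsto_0:
  "((\<lambda>x. psi_lower (- \<i> * of_real x)) \<longlongrightarrow> e1 (1 / 24)) (at_right 0)"
proof -
  have "((\<lambda>x. x * ln (1 - exp (- 2 * pi * x))) \<longlongrightarrow> 0) (at_right 0)"
    by real_asymp
  then have lim1: "((\<lambda>x. - \<i> * of_real (x * ln (1 - exp (- 2 * pi * x)))) \<longlongrightarrow> - \<i> * of_real 0) (at_right 0)"
    by (intro tendsto_intros)
  have "((\<lambda>x. complex_of_real (exp (- 2 * pi * x))) \<longlongrightarrow> of_real (exp (- 2 * pi * 0))) (at_right 0)"
    by (intro tendsto_intros)
  moreover have "eventually (\<lambda>x. complex_of_real (exp (- 2 * pi * x)) \<in> cball 0 1) (at_right 0)"
    by (intro eventually_at_rightI[of 0 1]) auto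
  ultimately have lim2: "((\<lambda>x. Li2 (of_real (exp (- 2 * pi * x)))) \<longlongrightarrow> Li2 1) (at_right 0)"
    by (intro continuous_on_tendsto_compose[OF continuous_on_Li2]) auto
  have "((\<lambda>x. exp (- \<i> * of_real (x * ln (1 - exp (- 2 * pi * x)))
           - 1 / (2 * of_real pi * \<i>) * Li2 (of_real (exp (- 2 * pi * x)))))
         \<longlongrightarrow> exp (- \<i> * of_real 0 - 1 / (2 * of_real pi * \<i>) * Li2 1)) (at_right 0)"
    by (intro tendsto_intros lim1 lim2)
  also have "- \<i> * of_real 0 - 1 / (2 * of_real pi * \<i>) * Li2 1 = 2 * of_real pi * \<i> * (1 / 24)"
    by (simp add: Li2_1 field_simps power2_eq_square)
  finally have "((\<lambda>x. exp (- \<i> * of_real (x * ln (1 - exp (- 2 * pi * x)))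
           - 1 / (2 * of_real pi * \<i>) * Li2 (of_real (exp (- 2 * pi * x)))))
         \<longlongrightarrow> e1 (1 / 24)) (at_right 0)"
    unfolding e1_def .
  moreover have "eventually (\<lambda>x. exp (- \<i> * of_real (x * ln (1 - exp (- 2 * pi * x)))
           - 1 / (2 * of_real pi * \<i>) * Li2 (of_real (exp (- 2 * pi * x)))) =
           psi_lower (- \<i> * of_real x)) (at_right 0)"
  proof (intro eventually_at_rightI[of 0 1])
    fix x :: real assume x: "x \<in> {0<..<1}"
    define r where "r = exp (- 2 * pi * x)"
    have r: "0 < r" "r < 1" using x by (auto simp: r_def)
    have e: "exp (- (2 * of_real pi * \<i> * (- \<i> * of_real x))) = complex_of_real r"
      by (simp add: r_def exp_of_real [symmetric] mult_ac)
    have "ln (1 - complex_of_real r) = of_real (ln (1 - r))"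
      using r Ln_of_real[of "1 - r"] by simp
    then have "ln_one_minus (of_real r) = of_real (ln (1 - r))"
      using r by (subst ln_one_minus_eq) auto
    then show "exp (- \<i> * of_real (x * ln (1 - exp (- 2 * pi * x)))
           - 1 / (2 * of_real pi * \<i>) * Li2 (of_real (exp (- 2 * pi * x)))) =
           psi_lower (- \<i> * of_real x)"
      unfolding psi_lower_def e r_def [symmetric] by (simp add: mult_ac)
  qed simp
  ultimately show ?thesis
    by (rule Lim_transform_eventually)
qed

lemma psi_strip_eq_psi_lower:
  assumes "t \<in> unit_strip" "Im t < 0"
  shows "psi_strip t = psi_lower t"
proof -
  define U where "U = unit_strip \<inter> {t. Im t < 0}"
  have "convex U"
    unfolding U_def by (intro convex_Int convex_unit_strip convex_halfspace_Im_lt)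
  define f where "f = (\<lambda>t. psi_lower t / psi_strip t)"
  have "(f has_field_derivative 0) (at x within U)" if x: "x \<in> U" for x
  proof -
    have "(f has_field_derivative (psi_lower x * psi_dlog x * psi_strip x 
             - psi_lower x * (psi_strip x * psi_dlog x)) / (psi_strip x * psi_strip x)) (at x)"
      unfolding f_def using x by (intro DERIV_divide DERIV_psi_lower DERIV_psi_strip) (auto simp: U_def)
    then show ?thesis by (simp add: has_field_derivative_at_within)
  qed
  with has_field_derivative_zero_constant[OF \<open>convex U\<close>, of f]
  obtain c where c: "\<And>x. x \<in> U \<Longrightarrow> f x = c" by auto
  have "isCont psi_strip 0"
    by (intro DERIV_isCont[OF DERIV_psi_strip]) (simp add: unit_strip_def)
  moreover have "((\<lambda>x. - \<i> * complex_of_real x) \<longlongrightarrow> - \<i> * of_real 0) (at_right 0)"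
    by (intro tendsto_intros)
  ultimately have "((\<lambda>x. psi_strip (- \<i> * of_real x)) \<longlongrightarrow> psi_strip 0) (at_right 0)"
    using isCont_tendsto_compose[of 0 psi_strip] by simp
  \<comment> \<open>the constant quotient of the two functions is determined by their limits at \<open>0\<close>\<close>
  from tendsto_divide[OF psi_lower_tendsto_0 this]
  have "((\<lambda>x. f (- \<i> * of_real x)) \<longlongrightarrow> e1 (1 / 24) / psi_strip 0) (at_right 0)"
    unfolding f_def by simp
  moreover have "eventually (\<lambda>x. f (- \<i> * of_real x) = c) (at_right 0)"
    by (intro eventually_at_rightI[of 0 1] c) (auto simp: U_def unit_strip_def)
  ultimately have "((\<lambda>x::real. c) \<longlongrightarrow> e1 (1 / 24) / psi_strip 0) (at_right 0)"
    by (rule Lim_transform_eventually)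
  then have "c = 1"
    by (simp add: tendsto_const_iff)
  then show ?thesis
    using c[of t] assms by (simp add: U_def f_def)
qed

section \<open>Meromorphic continuation of psi\<close>

lemma psi_lower_shift:
  assumes "Im t < 0"
  shows "psi_lower t = psi_lower (t - of_int n) * (1 - e1 (- t)) powi n"
proof -
  define q where "q = e1 (- t)"
  have q: "norm q < 1" using norm_e1_less_1[of "- t"] assms by (simp add: q_def)
  have eq: "exp (- (2 * of_real pi * \<i> * t)) = q"
    by (simp add: q_def e1_def)
  have "e1 (- (t - of_int n)) = q"
    using e1_add[of "- t" "of_int n"] by (simp add: q_def)
  then have eq': "exp (- (2 * of_real pi * \<i> * (t - of_int n))) = q"
    unfolding e1_def by (simp only: mult_minus_right)
  have "1 - q \<noteq> 0" using q by auto
  then have pw: "(1 - q) powi n = exp (of_int n * ln (1 - q))"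
    by (simp add: exp_power_int [symmetric])
  show ?thesis
    unfolding psi_lower_def eq eq' ln_one_minus_eq[OF q] q_def [symmetric] pw exp_add [symmetric]
    by (simp add: algebra_simps)
qed

lemma psi_strip_shift:
  assumes "0 < Re t" "Re t < 1"
  shows "psi_strip t = psi_strip (t - 1) * (1 - e1 (- t))"
proof -
  define V where "V = {t. 0 < Re t} \<inter> {t. Re t < 1}"
  define U where "U = V \<inter> {t. Im t < 0}"
  have "open V" unfolding V_def
    by (intro open_Int open_halfspace_Re_gt open_halfspace_Re_lt)
  have "open U" unfolding U_def
    by (intro open_Int \<open>open V\<close> open_halfspace_Im_lt)
  have "connected V" unfolding V_def
    by (intro convex_connected convex_Int convex_halfspace_Re_gt convex_halfspace_Re_lt)
  have "Complex (1 / 2) (- 1) \<in> U" by (simp add: U_def V_def)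
  then have "U \<noteq> {}" by blast
  have V: "x \<in> unit_strip" "x - 1 \<in> unit_strip" if "x \<in> V" for x
    using that by (auto simp: V_def unit_strip_def)
  have "(psi_strip \<circ> (\<lambda>t. t - 1)) holomorphic_on V"
    by (rule holomorphic_on_compose_gen[OF _ holomorphic_psi_strip])
       (use V in \<open>auto intro!: holomorphic_intros\<close>)
  then have h1: "(\<lambda>t. psi_strip (t - 1) * (1 - e1 (- t))) holomorphic_on V"
    unfolding o_def by (intro holomorphic_intros)
  have h2: "psi_strip holomorphic_on V"
    using holomorphic_psi_strip by (rule holomorphic_on_subset) (use V in auto)
  show ?thesis
  proof (rule analytic_continuation_open[OF \<open>open U\<close> \<open>open V\<close> \<open>U \<noteq> {}\<close> \<open>connected V\<close> _ h2 h1])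
    fix x assume "x \<in> U"
    then have x: "x \<in> V" "Im x < 0" by (auto simp: U_def)
    then show "psi_strip x = psi_strip (x - 1) * (1 - e1 (- x))"
      using psi_strip_eq_psi_lower[of x] psi_strip_eq_psi_lower[of "x - 1"] V[of x]
        psi_lower_shift[of x 1] by simp
  qed (use assms in \<open>auto simp: U_def V_def\<close>)
qed

text \<open>The formula for \<open>\<psi>\<close> on the strip \<open>\<bar>Re t - n\<bar> < 1\<close> obtained by applying the shift formula \<open>n\<close> times.
  For \<open>n < 0\<close> the value at \<open>t = n\<close> is \<open>0\<close>, as required of a nicely meromorphic function at a pole.\<close>

definition psi_branch :: "int \<Rightarrow> complex \<Rightarrow> complex" where
  "psi_branch n t = psi_strip (t - of_int n) * (1 - e1 (- t)) powi n"

text \<open>The branches for neighbouring strips agree where both are defined (\<open>psi_branch_Suc\<close>), so they glue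
  to a function on the whole plane.\<close>

definition psi_ext :: "complex \<Rightarrow> complex" where
  "psi_ext t = psi_branch (round (Re t)) t"

lemma e1_minus_eq_1_iff: "e1 (- t) = 1 \<longleftrightarrow> t \<in> \<int>"
  by (simp add: e1_eq_1_iff)

lemma psi_branch_Suc:
  assumes "t - of_int n \<in> unit_strip" "t - of_int (n + 1) \<in> unit_strip"
  shows "psi_branch n t = psi_branch (n + 1) t"
proof -
  have t: "0 < Re (t - of_int n)" "Re (t - of_int n) < 1"
    using assms by (auto simp: unit_strip_def)
  have "t \<notin> \<int>"
  proof
    assume "t \<in> \<int>"
    then obtain m where "t = of_int m" by (auto elim: Ints_cases)
    with t show False by simp
  qed
  then have "1 - e1 (- t) \<noteq> 0" by (simp add: e1_minus_eq_1_iff)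
  moreover have "e1 (- (t - of_int n)) = e1 (- t)"
    using e1_add[of "- t" "of_int n"] by simp
  ultimately show ?thesis
    using psi_strip_shift[OF t] by (simp add: psi_branch_def power_int_add diff_diff_eq)
qed

lemma psi_ext_eq_branch:
  assumes "t - of_int n \<in> unit_strip"
  shows "psi_ext t = psi_branch n t"
proof -
  define m where "m = round (Re t)"
  have m: "t - of_int m \<in> unit_strip"
    using of_int_round_abs_le[of "Re t"] by (simp add: unit_strip_def m_def abs_minus_commute)
  from assms m have "\<bar>of_int m - of_int n\<bar> < (2 :: real)"
    by (simp add: unit_strip_def)
  \<comment> \<open>at most two consecutive strips contain a given point\<close>
  then have "m = n \<or> m = n + 1 \<or> n = m + 1" by linarith
  then show ?thesis
    using psi_branch_Suc[of t n] psi_branch_Suc[of t m] assms m by (auto simp: psi_ext_def m_def)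
qed

text \<open>The complement of the set of zeros and poles of \<open>\<psi>\<close>.\<close>

definition psi_regular :: "complex set" where
  "psi_regular = - (\<int> - {0})"

lemma psi_ext_nonzero:
  assumes "t \<in> psi_regular"
  shows "psi_ext t \<noteq> 0"
proof (cases "t = 0")
  case False
  then have "1 - e1 (- t) \<noteq> 0" using assms by (simp add: psi_regular_def e1_minus_eq_1_iff)
  then show ?thesis by (simp add: psi_ext_def psi_branch_def)
qed (simp add: psi_ext_def psi_branch_def)

lemma psi_ext_0: "psi_ext 0 = e1 (1 / 24)"
  by (simp add: psi_ext_def psi_branch_def)

lemma psi_ext_lower:
  assumes "Im t < 0"
  shows "psi_ext t = psi_lower t"
proof -
  have "t - of_int (round (Re t)) \<in> unit_strip"
    using of_int_round_abs_le[of "Re t"] by (simp add: unit_strip_def abs_minus_commute)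
  then show ?thesis
    using psi_lower_shift[OF assms, of "round (Re t)"] assms 
      psi_strip_eq_psi_lower[of "t - of_int (round (Re t))"]
    by (simp add: psi_ext_def psi_branch_def)
qed

lemma psi_ext_shift:
  assumes "t \<notin> \<int>"
  shows "psi_ext (t + 1) = psi_ext t * (1 - e1 (- t))"
proof -
  have "1 - e1 (- t) \<noteq> 0" using assms by (simp add: e1_minus_eq_1_iff)
  moreover have "round (Re (t + 1)) = round (Re t) + 1"
    unfolding round_def by simp linarith
  moreover have "e1 (- t - 1) = e1 (- t)"
    by (simp add: e1_diff e1_minus divide_inverse)
  ultimately show ?thesis
    by (simp add: psi_ext_def psi_branch_def power_int_add)
qed

lemma psi_ext_reflect:
  assumes "t \<in> psi_regular"
  shows "psi_ext t * psi_ext (- t) = e1 (1 / 12 - t ^ 2 / 2)"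
proof (cases "t = 0")
  case True
  then show ?thesis by (simp add: psi_ext_0 flip: e1_add)
next
  case False
  then have nz: "1 - e1 t \<noteq> 0" using assms by (simp add: psi_regular_def e1_eq_1_iff)
  define n where "n = round (Re t)"
  have s: "t - of_int n \<in> unit_strip"
    using of_int_round_abs_le[of "Re t"] by (simp add: unit_strip_def n_def abs_minus_commute)
  then have s': "- t - of_int (- n) \<in> unit_strip"
    by (simp add: unit_strip_def abs_minus_commute)
  have "psi_ext t * psi_ext (- t) = psi_branch n t * psi_branch (- n) (- t)"
    using psi_ext_eq_branch[OF s] psi_ext_eq_branch[OF s'] by simp
  also have "\<dots> = psi_strip (t - of_int n) * psi_strip (- (t - of_int n)) * ((1 - e1 (- t)) / (1 - e1 t)) powi n"
    unfolding power_int_divide_distrib by (simp add: psi_branch_def power_int_minus field_simps)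
  also have "(1 - e1 (- t)) / (1 - e1 t) = - e1 (- t)"
    using nz by (simp add: e1_minus field_simps)
  also have "- e1 (- t) = e1 (1 / 2 - t)"
  proof -
    have "e1 (1 / 2) = - 1" by (simp add: e1_def)
    then show ?thesis unfolding e1_diff e1_minus by (simp add: inverse_eq_divide)
  qed
  also have "e1 (1 / 2 - t) powi n = e1 (of_int n * (1 / 2 - t))"
    by (simp add: e1_def exp_power_int mult_ac)
  also have "psi_strip (t - of_int n) * psi_strip (- (t - of_int n)) * e1 (of_int n * (1 / 2 - t)) =
      e1 (1 / 12 - (t - of_int n) ^ 2 / 2 + of_int n * (1 / 2 - t))"
    unfolding psi_strip_reflect[OF s] e1_add [symmetric] ..
  also have "1 / 12 - (t - of_int n) ^ 2 / 2 + of_int n * (1 / 2 - t) =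
      1 / 12 - t ^ 2 / 2 - of_int ((n ^ 2 - n) div 2)"
  proof -
    have "even (n ^ 2 - n)" by (simp add: power2_eq_square)
    then obtain k where k: "n ^ 2 - n = 2 * k" by (elim evenE)
    then have "(of_int n) ^ 2 - of_int n = 2 * complex_of_int k"
      by (metis k of_int_diff of_int_mult of_int_numeral of_int_power)
    then have m: "complex_of_int ((n ^ 2 - n) div 2) = (of_int n ^ 2 - of_int n) / 2"
      by (simp add: k)
    show ?thesis unfolding m by (simp add: field_simps power2_eq_square)
  qed
  also have "e1 \<dots> = e1 (1 / 12 - t ^ 2 / 2)"
    unfolding e1_diff[of _ "of_int _"] by simp
  finally show ?thesis .
qed

lemma psi_branch_analytic:
  assumes "z - of_int n \<in> unit_strip" "n \<ge> 0 \<or> z \<notin> \<int>"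
  shows "psi_branch n analytic_on {z}"
proof -
  have "psi_strip analytic_on unit_strip"
    using holomorphic_psi_strip open_unit_strip by (simp add: analytic_on_open)
  then have "(psi_strip \<circ> (\<lambda>t. t - of_int n)) analytic_on {z}"
    by (intro analytic_on_compose_gen[where T = unit_strip]) (use assms in \<open>auto intro!: analytic_intros\<close>)
  moreover have "(\<lambda>t. e1 (- t)) analytic_on {z}"
    unfolding e1_def by (intro analytic_intros)
  ultimately show ?thesis
    unfolding psi_branch_def [abs_def] o_def
    using assms(2) by (intro analytic_intros) (auto simp: e1_minus_eq_1_iff)
qed

lemma Ints_dist_less_1:
  fixes x y :: complex
  assumes "x \<in> \<int>" "y \<in> \<int>" "dist x y < 1"
  shows "x = y"
  using assms by (auto elim!: Ints_cases simp: dist_of_int)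

lemma psi_branch_pole:
  assumes "n < 0"
  shows "is_pole (psi_branch n) (of_int n)"
proof -
  define k where "k = nat (- n)"
  have k: "k > 0" "n = - int k" using assms by (auto simp: k_def)
  define z where "z = complex_of_int n"
  have "isCont psi_strip 0"
    by (intro DERIV_isCont[OF DERIV_psi_strip]) (simp add: unit_strip_def)
  then have c: "isCont (\<lambda>t. psi_strip (t - of_int n)) z"
    using isCont_o2[of z "\<lambda>t. t - of_int n" psi_strip] by (simp add: z_def)
  have "(\<lambda>t. (1 - e1 (- t)) ^ k) holomorphic_on UNIV"
    by (intro holomorphic_intros)
  then have "isCont (\<lambda>t. (1 - e1 (- t)) ^ k) z"
    using holomorphic_on_imp_continuous_on continuous_on_eq_continuous_at by blast
  then have lim: "((\<lambda>t. (1 - e1 (- t)) ^ k) \<longlongrightarrow> 0) (at z)"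
    using k by (simp add: isCont_def z_def e1_minus zero_power)
  have "eventually (\<lambda>t. t \<in> ball z 1 \<and> t \<noteq> z \<and> t \<in> UNIV) (at z)"
    by (rule eventually_at_ball') auto
  then have ev: "eventually (\<lambda>t. (1 - e1 (- t)) ^ k \<noteq> 0) (at z)"
  proof eventually_elim
    case (elim t)
    then have "t \<notin> \<int>"
      using Ints_dist_less_1[of z t] by (auto simp: z_def)
    then show ?case by (simp add: e1_minus_eq_1_iff)
  qed
  have "is_pole (\<lambda>t. psi_strip (t - of_int n) / (1 - e1 (- t)) ^ k) z"
    by (intro is_pole_divide c filterlim_atI lim ev) simp
  moreover have "psi_branch n = (\<lambda>t. psi_strip (t - of_int n) / (1 - e1 (- t)) ^ k)"
    by (simp add: fun_eq_iff psi_branch_def k power_int_minus divide_inverse)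
  ultimately show ?thesis by (simp add: z_def)
qed

lemma eventually_psi_ext_eq_branch:
  assumes "z - of_int n \<in> unit_strip"
  shows "eventually (\<lambda>t. psi_ext t = psi_branch n t) (nhds z)"
proof -
  have "open ((\<lambda>t. t - complex_of_int n) -` unit_strip)"
    by (intro open_vimage open_unit_strip continuous_intros)
  then have "eventually (\<lambda>t. t \<in> (\<lambda>t. t - complex_of_int n) -` unit_strip) (nhds z)"
    using assms by (intro eventually_nhds_in_open) auto
  then show ?thesis
    by eventually_elim (use psi_ext_eq_branch in auto)
qed

lemma psi_ext_analytic:
  assumes "z \<in> psi_regular"
  shows "psi_ext analytic_on {z}"
proof -
  define n where "n = round (Re z)"
  have n: "z - of_int n \<in> unit_strip"
    using of_int_round_abs_le[of "Re z"] by (simp add: unit_strip_def n_def abs_minus_commute)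
  have "n \<ge> 0 \<or> z \<notin> \<int>"
    using assms by (auto simp: psi_regular_def n_def)
  then have "psi_branch n analytic_on {z}"
    by (rule psi_branch_analytic[OF n])
  then show ?thesis
    using analytic_at_cong[OF eventually_psi_ext_eq_branch[OF n] refl] by blast
qed

lemma nicely_meromorphic_psi_ext: "psi_ext nicely_meromorphic_on UNIV"
proof -
  have "psi_ext analytic_on {z} \<or> is_pole psi_ext z \<and> psi_ext z = 0" for z
  proof (cases "z \<in> psi_regular")
    case True
    then show ?thesis using psi_ext_analytic by blast
  next
    case False
    then obtain n where z: "z = of_int n" by (auto simp: psi_regular_def elim: Ints_cases)
    then have s: "z - of_int n \<in> unit_strip" by (simp add: unit_strip_def)
    note ev = eventually_psi_ext_eq_branch[OF s]
    show ?thesis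
    proof (cases "n \<ge> 0")
      case True
      then have "psi_branch n analytic_on {z}"
        by (intro psi_branch_analytic[OF s]) auto
      then show ?thesis
        using analytic_at_cong[OF ev refl] by blast
    next
      case n: False
      have "eventually (\<lambda>t. psi_ext t = psi_branch n t) (at z)"
        using ev by (simp add: eventually_nhds_conv_at)
      then have "is_pole psi_ext z"
        using is_pole_cong[OF _ refl, of psi_ext "psi_branch n" z] psi_branch_pole[of n] n z by simp
      moreover have "psi_ext z = 0"
        using n psi_ext_eq_branch[OF s] by (simp add: psi_branch_def z e1_minus)
      ultimately show ?thesis by blast
    qed
  qed
  note * = this
  show ?thesis
  proof (rule nicely_meromorphic_onI_open)
    show "psi_ext analytic_on UNIV - {z. \<not> psi_ext analytic_on {z}}"
      by (subst analytic_on_analytic_at) auto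
    show "is_pole psi_ext x \<and> psi_ext x = 0" if "x \<in> {z. \<not> psi_ext analytic_on {z}}" for x
      using * that by blast
    show "isolated_singularity_at psi_ext x" for x
    proof (cases "x \<in> psi_regular")
      case True
      then show ?thesis
        by (intro isolated_singularity_at_analytic psi_ext_analytic)
    next
      case False
      then have "psi_ext analytic_on {y}" if "y \<in> ball x 1 - {x}" for y
        using that Ints_dist_less_1[of x y] by (intro psi_ext_analytic) (auto simp: psi_regular_def)
      then have "psi_ext analytic_on ball x 1 - {x}"
        using analytic_on_analytic_at by blast
      then show ?thesis
        unfolding isolated_singularity_at_def by (intro exI[of _ 1]) simp
    qed
  qed auto
qed

text \<open>The identity theorem; it identifies \<open>psi\<close> with the function constructed above.\<close>

lemma nicely_meromorphic_unique:
  assumes f: "f nicely_meromorphic_on UNIV" and g: "g nicely_meromorphic_on UNIV"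
    and "open U" "U \<noteq> {}" and eq: "\<And>x. x \<in> U \<Longrightarrow> f x = g x"
  shows "f = g"
proof
  fix z
  have "(\<lambda>x. f x - g x) meromorphic_on UNIV"
    using f g by (auto simp: nicely_meromorphic_on_def intro!: meromorphic_intros)
  then have "(\<forall>\<^sub>\<approx>x\<in>UNIV. f x - g x = 0) \<or> (\<forall>\<^sub>\<approx>x\<in>UNIV. f x - g x \<noteq> 0)"
    by (intro meromorphic_imp_constant_or_avoid) auto
  moreover have "\<not> (\<forall>\<^sub>\<approx>x\<in>UNIV. f x - g x \<noteq> 0)"
  proof
    assume *: "\<forall>\<^sub>\<approx>x\<in>UNIV. f x - g x \<noteq> 0"
    obtain u where u: "u \<in> U" using \<open>U \<noteq> {}\<close> by blast
    have "eventually (\<lambda>x. f x - g x \<noteq> 0) (at u)"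
      using * by (simp add: eventually_cosparse_open_eq)
    moreover have "eventually (\<lambda>x. x \<in> U) (at u)"
      using \<open>open U\<close> u by (rule eventually_at_in_open')
    ultimately have "eventually (\<lambda>x. False) (at u)"
      by eventually_elim (use eq in auto)
    then show False by simp
  qed
  ultimately have "\<forall>\<^sub>\<approx>x\<in>UNIV. f x - g x = 0" by blast
  then have ev: "eventually (\<lambda>x. f x = g x) (at z)"
    by (simp add: eventually_cosparse_open_eq)
  then have pole: "is_pole f z \<longleftrightarrow> is_pole g z"
    by (rule is_pole_cong) simp
  have fz: "(is_pole f z \<and> f z = 0) \<or> f \<midarrow>z\<rightarrow> f z" and gz: "(is_pole g z \<and> g z = 0) \<or> g \<midarrow>z\<rightarrow> g z"
    using f g by (auto simp: nicely_meromorphic_on_def)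
  show "f z = g z"
  proof (cases "is_pole f z")
    case True
    then have "\<not> f \<midarrow>z\<rightarrow> f z" "\<not> g \<midarrow>z\<rightarrow> g z"
      using pole not_tendsto_and_filterlim_at_infinity[of "at z"]
      unfolding is_pole_def by auto
    then show ?thesis using fz gz by auto
  next
    case False
    then have "f \<midarrow>z\<rightarrow> f z" "g \<midarrow>z\<rightarrow> g z" using fz gz pole by auto
    moreover from this(2) have "f \<midarrow>z\<rightarrow> g z"
      using tendsto_cong[OF ev] by blast
    ultimately show ?thesis
      using LIM_unique by blast
  qed
qed

lemma psi_eq_psi_ext: "psi = psi_ext"
  unfolding psi_def
proof (rule the_equality)
  show "psi_ext nicely_meromorphic_on UNIV \<and> (\<forall>t. Im t < 0 \<longrightarrow> psi_ext t = psi_lower t)"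
    using nicely_meromorphic_psi_ext psi_ext_lower by blast
next
  fix f assume f: "f nicely_meromorphic_on UNIV \<and> (\<forall>t. Im t < 0 \<longrightarrow> f t = psi_lower t)"
  have "- \<i> \<in> {t. Im t < 0}" by simp
  then have "{t. Im t < 0} \<noteq> {}" by blast
  then show "f = psi_ext"
    using f nicely_meromorphic_psi_ext psi_ext_lower
    by (intro nicely_meromorphic_unique[of _ _ "{t. Im t < 0}"] open_halfspace_Im_lt) auto
qed

lemmas psi_0 = psi_ext_0 [folded psi_eq_psi_ext]
  and psi_nonzero = psi_ext_nonzero [folded psi_eq_psi_ext]
  and psi_shift = psi_ext_shift [folded psi_eq_psi_ext]
  and psi_reflect = psi_ext_reflect [folded psi_eq_psi_ext]
  and psi_lower_half = psi_ext_lower [folded psi_eq_psi_ext]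

lemma holomorphic_psi: "psi holomorphic_on psi_regular"
  unfolding psi_eq_psi_ext using psi_ext_analytic
  by (intro analytic_imp_holomorphic) (subst analytic_on_analytic_at, auto)

lemma holomorphic_on_psi [holomorphic_intros]:
  assumes "f holomorphic_on S" "\<And>x. x \<in> S \<Longrightarrow> f x \<in> psi_regular"
  shows "(\<lambda>x. psi (f x)) holomorphic_on S"
  using holomorphic_on_compose_gen[OF assms(1) holomorphic_psi] assms(2)
  by (auto simp: o_def)

text \<open>The logarithm of \<open>\<psi>\<close> given by its defining formula on the lower half-plane.\<close>

definition log_psi :: "complex \<Rightarrow> complex" where
  "log_psi t = t * ln_one_minus (e1 (- t)) - 1 / (2 * of_real pi * \<i>) * Li2 (e1 (- t))"

lemma psi_eq_exp_log_psi: "Im t < 0 \<Longrightarrow> psi t = exp (log_psi t)"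
  by (simp add: psi_lower_half psi_lower_def log_psi_def e1_def)

lemma norm_log_psi_le:
  assumes "exp (2 * pi * Im t) \<le> 1 / 2"
  shows "norm (log_psi t) \<le> 2 * (norm t + 1) * exp (2 * pi * Im t)"
proof -
  have q: "norm (e1 (- t)) = exp (2 * pi * Im t)" by (simp add: norm_e1)
  have "norm (log_psi t) \<le> norm t * norm (ln_one_minus (e1 (- t))) + 1 / (2 * pi) * norm (Li2 (e1 (- t)))"
    unfolding log_psi_def by (rule norm_triangle_le_diff) (simp add: norm_mult norm_divide)
  also have "\<dots> \<le> norm t * (2 * exp (2 * pi * Im t)) + 1 * (2 * exp (2 * pi * Im t))"
    using pi_gt3 norm_ln_one_minus_le[of "e1 (- t)"] norm_Li2_le[of "e1 (- t)"] assms q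
    by (intro add_mono mult_left_mono mult_mono) (auto simp: divide_simps)
  finally show ?thesis by (simp add: algebra_simps)
qed

section \<open>Infinite products of holomorphic functions\<close>

lemma convergent_prod_LIMSEQ_lessThan:
  fixes f :: "nat \<Rightarrow> complex"
  shows "convergent_prod f \<Longrightarrow> (\<lambda>n. \<Prod>i<n. f i) \<longlonglongrightarrow> prodinf f"
  using convergent_prod_LIMSEQ LIMSEQ_lessThan_iff_atMost by blast

lemma convergent_prod_bound:
  fixes f :: "nat \<Rightarrow> complex"
  assumes "summable M" "\<forall>\<^sub>F n in sequentially. norm (f n - 1) \<le> M n"
  shows "convergent_prod f"
proof -
  have "summable (\<lambda>n. norm (f n - 1))"
    by (rule summable_comparison_test_ev[OF _ assms(1)]) (use assms(2) in simp)
  then show ?thesis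
    by (intro abs_convergent_prod_imp_convergent_prod summable_imp_abs_convergent_prod)
qed

text \<open>Locally uniform domination of \<open>\<bar>f\<^sub>n - 1\<bar>\<close> by a summable sequence; finitely many factors are
  unrestricted, so that this makes sense even where some factors are not bounded.\<close>

definition locally_dominated_product :: "(nat \<Rightarrow> complex \<Rightarrow> complex) \<Rightarrow> complex set \<Rightarrow> bool" where
  "locally_dominated_product f S \<longleftrightarrow> (\<forall>z\<in>S. \<exists>d>0. \<exists>M. summable M \<and>
     (\<forall>\<^sub>F n in sequentially. \<forall>w\<in>cball z d. norm (f n w - 1) \<le> M n))"

lemma convergent_prod_locally_dominated:
  assumes "locally_dominated_product f S" "z \<in> S"
  shows "convergent_prod (\<lambda>n. f n z)"
proof -
  obtain d M where dM: "d > 0" "summable M"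
    "\<forall>\<^sub>F n in sequentially. \<forall>w\<in>cball z d. norm (f n w - 1) \<le> M n"
    using assms unfolding locally_dominated_product_def by blast
  from dM(3) have "\<forall>\<^sub>F n in sequentially. norm (f n z - 1) \<le> M n"
    by eventually_elim (use dM(1) in auto)
  with dM(2) show ?thesis by (rule convergent_prod_bound)
qed

lemma holomorphic_prodinf:
  assumes bd: "locally_dominated_product f S"
    and S: "open S" and hol: "\<And>n. f n holomorphic_on S"
  shows "(\<lambda>z. \<Prod>n. f n z) holomorphic_on S"
proof (rule holomorphic_uniform_sequence[OF S])
  show "(\<lambda>z. \<Prod>n<N. f n z) holomorphic_on S" for N
    by (intro holomorphic_intros hol)
  fix z assume z: "z \<in> S"
  obtain d M where dM: "d > 0" "summable M"
    "\<forall>\<^sub>F n in sequentially. \<forall>w\<in>cball z d. norm (f n w - 1) \<le> M n"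
    using bd z unfolding locally_dominated_product_def by blast
  obtain e where e: "e > 0" "cball z e \<subseteq> S"
    using S z open_contains_cball by blast
  define A where "A = cball z (min d e)"
  have A: "A \<subseteq> S" "A \<subseteq> cball z d" using e by (auto simp: A_def)
  have "uniformly_convergent_on A (\<lambda>N x. \<Sum>n<N. norm (f n x - 1))"
  proof (rule Weierstrass_m_test'_ev[OF _ dM(2)])
    show "\<forall>\<^sub>F n in sequentially. \<forall>x\<in>A. norm (norm (f n x - 1)) \<le> M n"
      using dM(3) by eventually_elim (use A in auto)
  qed
  then have "uniformly_convergent_on A (\<lambda>N x. \<Prod>n<N. f n x)"
    by (intro uniformly_convergent_on_prod')
       (use A hol holomorphic_on_imp_continuous_on holomorphic_on_subset in \<open>blast, auto simp: A_def\<close>)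
  then have "uniform_limit A (\<lambda>N x. \<Prod>n<N. f n x) (\<lambda>x. lim (\<lambda>N. \<Prod>n<N. f n x)) sequentially"
    by (simp add: uniformly_convergent_uniform_limit_iff)
  also have "?this \<longleftrightarrow> uniform_limit A (\<lambda>N x. \<Prod>n<N. f n x) (\<lambda>x. \<Prod>n. f n x) sequentially"
  proof (rule uniform_limit_cong')
    fix x assume "x \<in> A"
    then have "convergent_prod (\<lambda>n. f n x)"
      using convergent_prod_locally_dominated[OF bd] A by blast
    then show "lim (\<lambda>N. \<Prod>n<N. f n x) = (\<Prod>n. f n x)"
      by (intro limI convergent_prod_LIMSEQ_lessThan)
  qed auto
  finally show "\<exists>d>0. cball z d \<subseteq> S \<and>
      uniform_limit (cball z d) (\<lambda>N x. \<Prod>n<N. f n x) (\<lambda>x. \<Prod>n. f n x) sequentially"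
    using dM(1) e(1) A(1) unfolding A_def by (intro exI[of _ "min d e"]) auto
qed

lemma prodinf_split_first:
  fixes f :: "nat \<Rightarrow> complex"
  assumes "convergent_prod (\<lambda>n. f (Suc n))"
  shows "prodinf f = f 0 * (\<Prod>n. f (Suc n))"
  using has_prod_Suc_imp[OF convergent_prod_has_prod[OF assms]]
  by (simp add: has_prod_iff mult.commute)

section \<open>q-Pochhammer products\<close>

text \<open>The infinite q-Pochhammer symbol \<open>(y; q)\<^sub>\<infinity>\<close>.\<close>

definition qpoch :: "complex \<Rightarrow> complex \<Rightarrow> complex" where
  "qpoch q y = (\<Prod>k. 1 - y * q ^ k)"

text \<open>The iterated product of \<open>1 - y q\<^sup>j\<^sup>+\<^sup>k\<close> over \<open>j, k \<ge> 0\<close>.\<close>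

definition qpoch2 :: "complex \<Rightarrow> complex \<Rightarrow> complex" where
  "qpoch2 q y = (\<Prod>j. qpoch q (q ^ j * y))"

context
  fixes q :: complex
  assumes q: "norm q < 1"
begin

lemma locally_dominated_qpoch: "locally_dominated_product (\<lambda>n y. 1 - y * q ^ n) UNIV"
  unfolding locally_dominated_product_def
proof (rule ballI, goal_cases)
  case (1 z)
  show ?case
  proof (intro exI[of _ 1] exI[of _ "\<lambda>n. (norm z + 1) * norm q ^ n"] conjI always_eventually allI ballI)
  fix n and y :: complex assume "y \<in> cball z 1"
  then have "norm y \<le> norm z + 1"
    using norm_triangle_ineq2[of y z] by (simp add: dist_norm norm_minus_commute)
  then show "norm (1 - y * q ^ n - 1) \<le> (norm z + 1) * norm q ^ n"
    by (simp add: norm_mult norm_power mult_right_mono)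
  qed (use q in \<open>auto intro!: summable_mult summable_geometric\<close>)
qed

lemma convergent_prod_qpoch: "convergent_prod (\<lambda>k. 1 - y * q ^ k)"
  by (rule convergent_prod_locally_dominated[OF locally_dominated_qpoch]) simp

lemma holomorphic_qpoch: "qpoch q holomorphic_on UNIV"
  unfolding qpoch_def [abs_def]
  by (rule holomorphic_prodinf[OF locally_dominated_qpoch open_UNIV])
     (auto intro!: holomorphic_intros)

lemma qpoch_0: "qpoch q 0 = 1"
  by (simp add: qpoch_def)

lemma qpoch_rec: "qpoch q y = (1 - y) * qpoch q (q * y)"
  using prodinf_split_first[of "\<lambda>k. 1 - y * q ^ k"] convergent_prod_qpoch[of "q * y"]
  by (simp add: qpoch_def mult_ac)

lemma qpoch_nonzero: "(\<And>k. y * q ^ k \<noteq> 1) \<Longrightarrow> qpoch q y \<noteq> 0"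
  unfolding qpoch_def by (rule prodinf_nonzero[OF convergent_prod_qpoch]) (metis eq_iff_diff_eq_0)

lemma norm_mult_q_power_less_1: "norm y < 1 \<Longrightarrow> norm (y * q ^ k) < 1"
proof -
  assume "norm y < 1"
  moreover have "norm q ^ k \<le> 1" using q by (intro power_le_one) auto
  ultimately show ?thesis
    by (simp add: norm_mult norm_power) (metis mult_left_le norm_ge_zero order_le_less_trans)
qed

lemma qpoch_nonzero': "norm y < 1 \<Longrightarrow> qpoch q y \<noteq> 0"
  using norm_mult_q_power_less_1 by (intro qpoch_nonzero) (metis norm_one less_irrefl)

lemma locally_dominated_qpoch2: "locally_dominated_product (\<lambda>n y. qpoch q (q ^ n * y)) UNIV"
  unfolding locally_dominated_product_def
proof (rule ballI, goal_cases)
  case (1 z)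
  show ?case
  proof -
  obtain D where D: "(qpoch q has_field_derivative D) (at 0)"
    using holomorphic_qpoch by (auto simp: holomorphic_on_def field_differentiable_def)
  then have "((\<lambda>y. (qpoch q y - 1) / y) \<longlongrightarrow> D) (at 0)"
    by (simp add: has_field_derivative_iff qpoch_0)
  then have "((\<lambda>y. norm ((qpoch q y - 1) / y)) \<longlongrightarrow> norm D) (at 0)"
    by (rule tendsto_norm)
  then have "\<forall>\<^sub>F y in at 0. norm ((qpoch q y - 1) / y) < norm D + 1"
    by (rule order_tendstoD) simp
  then obtain e where e: "e > 0" "\<And>y. y \<noteq> 0 \<Longrightarrow> norm y < e \<Longrightarrow> norm ((qpoch q y - 1) / y) < norm D + 1"
    by (auto simp: eventually_at)
  have near: "norm (qpoch q y - 1) \<le> (norm D + 1) * norm y" if "norm y < e" for y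
  proof (cases "y = 0")
    case False
    with e(2)[OF this that] show ?thesis by (simp add: norm_divide divide_simps split: if_splits)
  qed (simp add: qpoch_0)
  have "(\<lambda>n. (norm z + 1) * norm q ^ n) \<longlonglongrightarrow> (norm z + 1) * 0"
    using q by (intro tendsto_mult tendsto_const LIMSEQ_power_zero) auto
  then have ev: "\<forall>\<^sub>F n in sequentially. (norm z + 1) * norm q ^ n < e"
    by (rule order_tendstoD) (use e in simp)
  define M where "M = (\<lambda>n. (norm D + 1) * ((norm z + 1) * norm q ^ n))"
  have "summable M"
    unfolding M_def using q by (intro summable_mult summable_geometric) auto
  moreover from ev have "\<forall>\<^sub>F n in sequentially. \<forall>y\<in>cball z 1. norm (qpoch q (q ^ n * y) - 1) \<le> M n"
  proof eventually_elim
    case (elim n)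
    show ?case
    proof
      fix y assume "y \<in> cball z 1"
      then have "norm y \<le> norm z + 1"
        using norm_triangle_ineq2[of y z] by (simp add: dist_norm norm_minus_commute)
      then have y: "norm (q ^ n * y) \<le> (norm z + 1) * norm q ^ n"
        by (simp add: norm_mult norm_power mult.commute mult_right_mono)
      then have "norm (qpoch q (q ^ n * y) - 1) \<le> (norm D + 1) * norm (q ^ n * y)"
        using elim by (intro near) simp
      also have "\<dots> \<le> M n"
        unfolding M_def using y by (intro mult_left_mono) auto
      finally show "norm (qpoch q (q ^ n * y) - 1) \<le> M n" .
    qed
  qed
  ultimately show ?thesis
    by (intro exI[of _ "1 :: real"] exI[of _ M] conjI) simp_all
  qed
qed

lemma holomorphic_qpoch_comp:
  "f holomorphic_on S \<Longrightarrow> (\<lambda>z. qpoch q (f z)) holomorphic_on S"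
  using holomorphic_on_compose_gen[of f S "qpoch q" UNIV] holomorphic_qpoch by (simp add: o_def)

lemma convergent_prod_qpoch2: "convergent_prod (\<lambda>j. qpoch q (q ^ j * y))"
  by (rule convergent_prod_locally_dominated[OF locally_dominated_qpoch2]) simp

lemma holomorphic_qpoch2: "qpoch2 q holomorphic_on UNIV"
  unfolding qpoch2_def [abs_def]
  by (rule holomorphic_prodinf[OF locally_dominated_qpoch2 open_UNIV])
     (auto intro!: holomorphic_intros holomorphic_qpoch_comp)

lemma holomorphic_qpoch2_comp:
  "f holomorphic_on S \<Longrightarrow> (\<lambda>z. qpoch2 q (f z)) holomorphic_on S"
  using holomorphic_on_compose_gen[of f S "qpoch2 q" UNIV] holomorphic_qpoch2 by (simp add: o_def)

lemma qpoch2_rec: "qpoch2 q y = qpoch q y * qpoch2 q (q * y)"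
  using prodinf_split_first[of "\<lambda>j. qpoch q (q ^ j * y)"] convergent_prod_qpoch2[of "q * y"]
  by (simp add: qpoch2_def mult_ac)

lemma qpoch2_nonzero: "norm y < 1 \<Longrightarrow> qpoch2 q y \<noteq> 0"
  unfolding qpoch2_def
  using norm_mult_q_power_less_1[of y]
  by (intro prodinf_nonzero convergent_prod_qpoch2 qpoch_nonzero') (simp add: mult.commute)

end

section \<open>Quasi-periodicity of the theta and elliptic gamma functions\<close>

lemma theta0_factor_eq:
  "exp (2 * of_real pi * \<i> * ((of_nat j + 1) * \<tau> - z)) = e1 (\<tau> - z) * e1 \<tau> ^ j"
  "exp (2 * of_real pi * \<i> * (of_nat j * \<tau> + z)) = e1 z * e1 \<tau> ^ j"
  unfolding e1_power e1_add [symmetric] unfolding e1_def by (simp_all add: algebra_simps)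

context
  fixes \<tau> :: complex
  assumes tau: "Im \<tau> > 0"
begin

lemma theta0_eq: "theta0 z \<tau> = qpoch (e1 \<tau>) (e1 (\<tau> - z)) * qpoch (e1 \<tau>) (e1 z)"
  unfolding theta0_def theta0_factor_eq qpoch_def
  by (intro prodinf_mult [symmetric] convergent_prod_qpoch norm_e1_less_1 tau)

lemma ell_Gamma_eq: "ell_Gamma z \<tau> \<tau> = qpoch2 (e1 \<tau>) (e1 (2 * \<tau> - z)) / qpoch2 (e1 \<tau>) (e1 z)"
proof -
  have e: "exp (2 * of_real pi * \<i> * ((of_nat j + 1) * \<tau> + (of_nat k + 1) * \<tau> - z))
      = (e1 \<tau> ^ j * e1 (2 * \<tau> - z)) * e1 \<tau> ^ k"
    "exp (2 * of_real pi * \<i> * (of_nat j * \<tau> + of_nat k * \<tau> + z)) = (e1 \<tau> ^ j * e1 z) * e1 \<tau> ^ k" for j k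
    unfolding e1_power e1_add [symmetric] unfolding e1_def by (simp_all add: algebra_simps)
  show ?thesis
    unfolding ell_Gamma_def e qpoch2_def
    by (subst prodinf_divide, (intro convergent_prod_qpoch2 norm_e1_less_1 tau)+,
        intro prodinf_cong)
       (subst prodinf_divide [symmetric],
        (intro convergent_prod_qpoch norm_e1_less_1 tau)+, simp add: qpoch_def)
qed

end

text \<open>The lattice \<open>\<int> + \<tau> \<int>\<close>.\<close>

definition period_lattice :: "complex \<Rightarrow> complex set" where
  "period_lattice \<tau> = {of_int m + of_int n * \<tau> | m n :: int. True}"

lemma period_latticeI: "z = of_int m + of_int n * \<tau> \<Longrightarrow> z \<in> period_lattice \<tau>"
  by (auto simp: period_lattice_def)

lemma period_lattice_add_1: "z + 1 \<in> period_lattice \<tau> \<longleftrightarrow> z \<in> period_lattice \<tau>"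
proof
  assume "z + 1 \<in> period_lattice \<tau>"
  then obtain m n :: int where "z + 1 = of_int m + of_int n * \<tau>" by (auto simp: period_lattice_def)
  then show "z \<in> period_lattice \<tau>"
    by (intro period_latticeI[of _ "m - 1" n]) (simp add: algebra_simps)
next
  assume "z \<in> period_lattice \<tau>"
  then obtain m n :: int where "z = of_int m + of_int n * \<tau>" by (auto simp: period_lattice_def)
  then show "z + 1 \<in> period_lattice \<tau>"
    by (intro period_latticeI[of _ "m + 1" n]) (simp add: algebra_simps)
qed

lemma period_lattice_add_tau: "z + \<tau> \<in> period_lattice \<tau> \<longleftrightarrow> z \<in> period_lattice \<tau>"
proof
  assume "z + \<tau> \<in> period_lattice \<tau>"
  then obtain m n :: int where "z + \<tau> = of_int m + of_int n * \<tau>" by (auto simp: period_lattice_def)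
  then show "z \<in> period_lattice \<tau>"
    by (intro period_latticeI[of _ m "n - 1"]) (simp add: algebra_simps)
next
  assume "z \<in> period_lattice \<tau>"
  then obtain m n :: int where "z = of_int m + of_int n * \<tau>" by (auto simp: period_lattice_def)
  then show "z + \<tau> \<in> period_lattice \<tau>"
    by (intro period_latticeI[of _ m "n + 1"]) (simp add: algebra_simps)
qed

lemma period_lattice_mult_modulus:
  assumes "\<tau> \<noteq> 0"
  shows "z / \<tau> \<in> period_lattice (- 1 / \<tau>) \<longleftrightarrow> z \<in> period_lattice \<tau>"
proof
  assume "z / \<tau> \<in> period_lattice (- 1 / \<tau>)"
  then obtain m n :: int where "z / \<tau> = of_int m + of_int n * (- 1 / \<tau>)"
    by (auto simp: period_lattice_def)
  then show "z \<in> period_lattice \<tau>"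
    using assms by (intro period_latticeI[of _ "- n" m]) (simp add: field_simps)
next
  assume "z \<in> period_lattice \<tau>"
  then obtain m n :: int where "z = of_int m + of_int n * \<tau>" by (auto simp: period_lattice_def)
  then show "z / \<tau> \<in> period_lattice (- 1 / \<tau>)"
    using assms by (intro period_latticeI[of _ n "- m"]) (simp add: field_simps)
qed

lemma convergent_prod_theta0:
  assumes "Im \<tau> > 0"
  shows "convergent_prod (\<lambda>j. (1 - exp (2 * of_real pi * \<i> * ((of_nat j + 1) * \<tau> - z))) *
           (1 - exp (2 * of_real pi * \<i> * (of_nat j * \<tau> + z))))"
  unfolding theta0_factor_eq by (intro convergent_prod_mult convergent_prod_qpoch norm_e1_less_1 assms)

section \<open>The infinite product of psi functions\<close>

lemma psi_regularI: "Im t \<noteq> 0 \<Longrightarrow> t \<in> psi_regular"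
  by (auto simp: psi_regular_def elim!: Ints_cases)

definition psi_factor :: "complex \<Rightarrow> nat \<Rightarrow> complex \<Rightarrow> complex" where
  "psi_factor \<tau> k z = psi ((of_nat k + 1 + z) / \<tau>) / psi ((of_nat k - z) / \<tau>)"

definition psi_prod :: "complex \<Rightarrow> complex \<Rightarrow> complex" where
  "psi_prod \<tau> z = (\<Prod>k. psi_factor \<tau> k z)"

text \<open>The points at which none of the factors of \<open>psi_prod \<tau>\<close>, nor those of its translates by integers,
  meets a zero or a pole of \<open>\<psi>\<close>.  It contains \<open>0\<close> and all points outside the lattice.\<close>

definition psi_dom :: "complex \<Rightarrow> complex set" where
  "psi_dom \<tau> = {z. \<forall>k::int. (of_int k + z) / \<tau> \<in> psi_regular}"

context
  fixes \<tau> :: complex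
  assumes tau: "Im \<tau> > 0"
begin

lemma norm_e1_tau: "norm (e1 \<tau>) < 1"
  using tau by (rule norm_e1_less_1)

lemma qpoch_e1_nonzero:
  assumes "z \<notin> period_lattice \<tau>"
  shows "qpoch (e1 \<tau>) (e1 z) \<noteq> 0" "qpoch (e1 \<tau>) (e1 (\<tau> - z)) \<noteq> 0"
proof -
  have "e1 z * e1 \<tau> ^ k \<noteq> 1" for k
  proof
    assume "e1 z * e1 \<tau> ^ k = 1"
    then have "z + of_nat k * \<tau> \<in> \<int>"
      by (simp add: e1_power e1_add [symmetric] e1_eq_1_iff)
    then obtain m :: int where "z + of_nat k * \<tau> = of_int m" by (elim Ints_cases)
    then have "z = of_int m + of_int (- int k) * \<tau>" by (simp add: algebra_simps)
    with assms show False by (blast intro: period_latticeI)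
  qed
  then show "qpoch (e1 \<tau>) (e1 z) \<noteq> 0"
    by (intro qpoch_nonzero norm_e1_tau)
  have "e1 (\<tau> - z) * e1 \<tau> ^ k \<noteq> 1" for k
  proof
    assume "e1 (\<tau> - z) * e1 \<tau> ^ k = 1"
    then have "\<tau> - z + of_nat k * \<tau> \<in> \<int>"
      by (simp add: e1_power e1_add [symmetric] e1_eq_1_iff)
    then obtain m :: int where "\<tau> - z + of_nat k * \<tau> = of_int m" by (elim Ints_cases)
    then have "z = of_int (- m) + of_int (int k + 1) * \<tau>" by (simp add: algebra_simps)
    with assms show False by (blast intro: period_latticeI)
  qed
  then show "qpoch (e1 \<tau>) (e1 (\<tau> - z)) \<noteq> 0"
    by (intro qpoch_nonzero norm_e1_tau)
qed

lemma theta0_nonzero: "z \<notin> period_lattice \<tau> \<Longrightarrow> theta0 z \<tau> \<noteq> 0"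
  using qpoch_e1_nonzero by (simp add: theta0_eq[OF tau])

lemma theta0_add_1: "theta0 (z + 1) \<tau> = theta0 z \<tau>"
  by (simp add: theta0_eq[OF tau] e1_add e1_diff)

lemma theta0_minus_1: "theta0 (z - 1) \<tau> = theta0 z \<tau>"
  using theta0_add_1[of "z - 1"] by simp

lemma theta0_add_tau:
  assumes "z \<notin> period_lattice \<tau>"
  shows "theta0 (z + \<tau>) \<tau> = - theta0 z \<tau> / e1 z"
proof -
  have "z \<notin> \<int>"
    using assms period_latticeI[of z _ 0 \<tau>] by (auto elim!: Ints_cases)
  then have "e1 z \<noteq> 1" by (simp add: e1_eq_1_iff)
  define u where "u = 1 - e1 z"
  have u: "u \<noteq> 0" using \<open>e1 z \<noteq> 1\<close> by (simp add: u_def)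
  have "theta0 (z + \<tau>) \<tau> = qpoch (e1 \<tau>) (e1 (- z)) * qpoch (e1 \<tau>) (e1 \<tau> * e1 z)"
    by (simp add: theta0_eq[OF tau] e1_add mult.commute)
  also have "qpoch (e1 \<tau>) (e1 (- z)) = (1 - e1 (- z)) * qpoch (e1 \<tau>) (e1 (\<tau> - z))"
    by (subst qpoch_rec[OF norm_e1_tau]) (simp flip: e1_add)
  also have "qpoch (e1 \<tau>) (e1 \<tau> * e1 z) = qpoch (e1 \<tau>) (e1 z) / u"
    using u by (subst (2) qpoch_rec[OF norm_e1_tau]) (simp add: u_def)
  also have "1 - e1 (- z) = - u / e1 z"
    by (simp add: e1_minus field_simps u_def)
  finally show ?thesis
    using u by (simp add: theta0_eq[OF tau])
qed

lemma ell_Gamma_add_1: "ell_Gamma (z + 1) \<tau> \<tau> = ell_Gamma z \<tau> \<tau>"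
  by (simp add: ell_Gamma_eq[OF tau] e1_add e1_diff)

lemma ell_Gamma_add_tau:
  assumes "z \<notin> period_lattice \<tau>"
  shows "ell_Gamma (z + \<tau>) \<tau> \<tau> = theta0 z \<tau> * ell_Gamma z \<tau> \<tau>"
proof -
  note nz = qpoch_e1_nonzero[OF assms]
  have "ell_Gamma (z + \<tau>) \<tau> \<tau> = qpoch2 (e1 \<tau>) (e1 (\<tau> - z)) / qpoch2 (e1 \<tau>) (e1 \<tau> * e1 z)"
    by (simp add: ell_Gamma_eq[OF tau] e1_add [symmetric] algebra_simps)
  also have "qpoch2 (e1 \<tau>) (e1 (\<tau> - z)) = qpoch (e1 \<tau>) (e1 (\<tau> - z)) * qpoch2 (e1 \<tau>) (e1 (2 * \<tau> - z))"
    by (subst qpoch2_rec[OF norm_e1_tau]) (simp add: e1_add [symmetric] algebra_simps)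
  also have "qpoch2 (e1 \<tau>) (e1 \<tau> * e1 z) = qpoch2 (e1 \<tau>) (e1 z) / qpoch (e1 \<tau>) (e1 z)"
    using nz by (subst (2) qpoch2_rec[OF norm_e1_tau]) simp
  finally show ?thesis
    by (simp add: theta0_eq[OF tau] ell_Gamma_eq[OF tau])
qed

lemma tau_nonzero: "\<tau> \<noteq> 0"
  using tau by auto

lemma Im_inverse_tau: "Im (1 / \<tau>) < 0"
proof -
  have "(Re \<tau>)\<^sup>2 + (Im \<tau>)\<^sup>2 > 0"
    using tau by (intro add_nonneg_pos) auto
  then show ?thesis
    using tau by (simp add: Im_divide)
qed

lemma Im_minus_inverse_tau: "Im (- 1 / \<tau>) > 0"
  using Im_inverse_tau by simp

lemma Im_of_nat_divide_tau: "Im (of_nat n / \<tau>) = real n * Im (1 / \<tau>)"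
proof -
  have "of_nat n / \<tau> = of_real (real n) * (1 / \<tau>)" by simp
  then show ?thesis
    by (simp only: times_complex.sel Re_complex_of_real Im_complex_of_real)
qed

text \<open>As \<open>Im (1 / \<tau>) < 0\<close>, the points \<open>(n + c) / \<tau>\<close> move down the lower half-plane at linear speed, where
  \<open>log_psi\<close> decays exponentially up to a linear factor.\<close>

lemma log_psi_uniform_bound:
  assumes "C \<ge> 0"
  obtains B :: "nat \<Rightarrow> real" where "summable B"
    "\<forall>\<^sub>F n in sequentially. \<forall>c. norm c \<le> C \<longrightarrow>
       Im ((of_nat n + c) / \<tau>) < 0 \<and> norm (log_psi ((of_nat n + c) / \<tau>)) \<le> B n"
proof -
  define y where "y = - Im (1 / \<tau>)"
  define r where "r = exp (- 2 * pi * y)"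
  define A where "A = exp (2 * pi * (C / norm \<tau>))"
  define K where "K = 2 * ((1 + C) / norm \<tau> + 1) * A"
  define B where "B = (\<lambda>n. K * (real (Suc n) * r ^ n))"
  have y: "y > 0" using Im_inverse_tau by (simp add: y_def)
  have r: "0 < r" "r < 1" using y by (auto simp: r_def)
  have A: "A > 0" by (simp add: A_def)
  have "norm \<tau> > 0" using tau_nonzero by simp
  have "(1 + C) / norm \<tau> \<ge> 0" using assms by simp
  then have "2 * 1 * A \<le> 2 * ((1 + C) / norm \<tau> + 1) * A"
    using A by (intro mult_right_mono mult_left_mono) linarith+
  then have K: "2 * A \<le> K" by (simp only: K_def mult_1_right)
  have "summable (\<lambda>n. real (Suc n) * r ^ n)"
    using geometric_deriv_sums[of r] r by (simp add: sums_iff)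
  then have sB: "summable B" unfolding B_def by (rule summable_mult)
  then have "B \<longlonglongrightarrow> 0" by (rule summable_LIMSEQ_zero)
  then have ev: "\<forall>\<^sub>F n in sequentially. B n < 1 / 2"
    by (rule order_tendstoD) simp
  have "\<forall>\<^sub>F n in sequentially. \<forall>c. norm c \<le> C \<longrightarrow>
       Im ((of_nat n + c) / \<tau>) < 0 \<and> norm (log_psi ((of_nat n + c) / \<tau>)) \<le> B n"
    using ev
  proof eventually_elim
    case (elim n)
    show ?case
    proof (intro allI impI)
      fix c :: complex assume c: "norm c \<le> C"
      define t where "t = (of_nat n + c) / \<tau>"
      have "Im t = - real n * y + Im (c / \<tau>)"
        by (simp add: t_def y_def add_divide_distrib Im_of_nat_divide_tau)
      moreover have "\<bar>Im (c / \<tau>)\<bar> \<le> C / norm \<tau>"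
        using abs_Im_le_cmod[of "c / \<tau>"] c divide_right_mono[OF c, of "norm \<tau>"]
        by (simp add: norm_divide)
      ultimately have Imt: "Im t \<le> C / norm \<tau> - real n * y" by linarith
      have "exp (2 * pi * Im t) \<le> exp (2 * pi * (C / norm \<tau> - real n * y))"
        using Imt by simp
      also have "\<dots> = A * r ^ n"
        by (simp add: A_def r_def exp_of_nat_mult [symmetric] exp_add [symmetric] algebra_simps)
      finally have e: "exp (2 * pi * Im t) \<le> A * r ^ n" .
      have "2 * A * (1 * r ^ n) \<le> B n"
        unfolding B_def using K A r by (intro mult_mono) auto
      then have e2: "exp (2 * pi * Im t) \<le> 1 / 2" using e elim by linarith
      then have "exp (2 * pi * Im t) < 1" by linarith
      then have neg: "Im t < 0" by (simp add: mult_less_0_iff)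
      have "norm t \<le> (real n + C) / norm \<tau>"
        unfolding t_def norm_divide using c norm_triangle_ineq[of "of_nat n" c]
        by (intro divide_right_mono) auto
      also have "\<dots> \<le> (real (Suc n) * (1 + C)) / norm \<tau>"
        using assms by (intro divide_right_mono) (auto simp: algebra_simps)
      finally have "norm t + 1 \<le> real (Suc n) * ((1 + C) / norm \<tau> + 1)"
        by (simp add: algebra_simps)
      then have "2 * (norm t + 1) * exp (2 * pi * Im t) \<le>
          2 * (real (Suc n) * ((1 + C) / norm \<tau> + 1)) * (A * r ^ n)"
        using e assms
        by (intro mult_mono) (auto intro!: mult_nonneg_nonneg add_nonneg_nonneg divide_nonneg_nonneg)
      also have "\<dots> = B n" by (simp add: B_def K_def)
      finally show "Im t < 0 \<and> norm (log_psi t) \<le> B n"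
        using norm_log_psi_le[OF e2] neg by simp
    qed
  qed
  with sB show thesis by (rule that)
qed

lemma psi_tendsto_1: "(\<lambda>n. psi ((of_nat n + c) / \<tau>)) \<longlonglongrightarrow> 1"
proof -
  obtain B where B: "summable B" "\<forall>\<^sub>F n in sequentially. \<forall>d. norm d \<le> norm c \<longrightarrow>
       Im ((of_nat n + d) / \<tau>) < 0 \<and> norm (log_psi ((of_nat n + d) / \<tau>)) \<le> B n"
    using log_psi_uniform_bound[of "norm c"] by auto
  have "(\<lambda>n. log_psi ((of_nat n + c) / \<tau>)) \<longlonglongrightarrow> 0"
    by (rule Lim_null_comparison[OF _ summable_LIMSEQ_zero[OF B(1)]])
       (use B(2) in \<open>auto elim!: eventually_mono\<close>)
  then have "(\<lambda>n. exp (log_psi ((of_nat n + c) / \<tau>))) \<longlonglongrightarrow> exp 0"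
    by (rule tendsto_exp)
  moreover have "\<forall>\<^sub>F n in sequentially. exp (log_psi ((of_nat n + c) / \<tau>)) = psi ((of_nat n + c) / \<tau>)"
    using B(2) by eventually_elim (use psi_eq_exp_log_psi in auto)
  ultimately show ?thesis
    using Lim_transform_eventually by fastforce
qed

lemma locally_dominated_psi_factor: "locally_dominated_product (psi_factor \<tau>) UNIV"
  unfolding locally_dominated_product_def
proof
  fix z :: complex
  obtain B where B: "summable B" "\<forall>\<^sub>F n in sequentially. \<forall>c. norm c \<le> norm z + 2 \<longrightarrow>
       Im ((of_nat n + c) / \<tau>) < 0 \<and> norm (log_psi ((of_nat n + c) / \<tau>)) \<le> B n"
    using log_psi_uniform_bound[of "norm z + 2"] by auto
  have "\<forall>\<^sub>F n in sequentially. B n < 1 / 4"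
    using summable_LIMSEQ_zero[OF B(1)] by (rule order_tendstoD) simp
  with B(2) have "\<forall>\<^sub>F n in sequentially. \<forall>w\<in>cball z 1. norm (psi_factor \<tau> n w - 1) \<le> 3 * B n"
  proof eventually_elim
    case (elim n)
    show ?case
    proof
      fix w assume "w \<in> cball z 1"
      then have "norm w \<le> norm z + 1"
        using norm_triangle_ineq2[of w z] by (simp add: dist_norm norm_minus_commute)
      then have nw: "norm (1 + w) \<le> norm z + 2" "norm (- w) \<le> norm z + 2"
        using norm_triangle_ineq[of 1 w] by auto
      define a where "a = log_psi ((of_nat n + (1 + w)) / \<tau>)"
      define b where "b = log_psi ((of_nat n + (- w)) / \<tau>)"
      have ab: "norm a \<le> B n" "norm b \<le> B n"
        using elim nw unfolding a_def b_def by blast+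
      have "psi ((of_nat n + (1 + w)) / \<tau>) = exp a" "psi ((of_nat n + (- w)) / \<tau>) = exp b"
        using elim nw unfolding a_def b_def by (blast intro: psi_eq_exp_log_psi)+
      then have "psi_factor \<tau> n w = exp (a - b)"
        by (simp add: psi_factor_def exp_diff add.assoc)
      moreover have "norm (a - b) \<le> 2 * B n"
        using ab norm_triangle_ineq4[of a b] by simp
      ultimately show "norm (psi_factor \<tau> n w - 1) \<le> 3 * B n"
        using norm_exp_bounds(2)[of "a - b"] elim(2) by simp
    qed
  qed
  then show "\<exists>d>0. \<exists>M. summable M \<and> (\<forall>\<^sub>F n in sequentially. \<forall>w\<in>cball z d. norm (psi_factor \<tau> n w - 1) \<le> M n)"
    using B(1) by (intro exI[of _ "1 :: real"] exI[of _ "\<lambda>n. 3 * B n"] conjI summable_mult) auto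
qed

lemma convergent_prod_psi_factor: "convergent_prod (\<lambda>k. psi_factor \<tau> k z)"
  by (rule convergent_prod_locally_dominated[OF locally_dominated_psi_factor]) simp

lemma psi_prod_LIMSEQ: "(\<lambda>N. \<Prod>k<N. psi_factor \<tau> k z) \<longlonglongrightarrow> psi_prod \<tau> z"
  unfolding psi_prod_def by (intro convergent_prod_LIMSEQ_lessThan convergent_prod_psi_factor)

lemma psi_prod_0: "psi_prod \<tau> 0 = e1 (- 1 / 24)"
proof -
  have nz: "psi (of_nat N / \<tau>) \<noteq> 0" for N
  proof (cases N)
    case (Suc n)
    have "Im (of_nat N / \<tau>) \<noteq> 0"
      using Im_inverse_tau Suc unfolding Im_of_nat_divide_tau by simp
    then show ?thesis by (intro psi_nonzero psi_regularI)
  qed (simp add: psi_0)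
  have "(\<Prod>k<N. psi_factor \<tau> k 0) = psi (of_nat N / \<tau>) / psi 0" for N
    by (induction N) (use nz in \<open>simp_all add: psi_0 psi_factor_def add.commute\<close>)
  moreover have "(\<lambda>N. psi (of_nat N / \<tau>) / psi 0) \<longlonglongrightarrow> 1 / psi 0"
    using psi_tendsto_1[of 0] by (intro tendsto_divide tendsto_const) (auto simp: psi_0)
  ultimately have "psi_prod \<tau> 0 = 1 / psi 0"
    using psi_prod_LIMSEQ[of 0] LIMSEQ_unique by simp
  then show ?thesis
    using e1_minus[of "1 / 24"] by (simp add: psi_0 inverse_eq_divide)
qed

lemma psi_dom_psi_nonzero:
  assumes "z \<in> psi_dom \<tau>"
  shows "psi ((of_int k + z) / \<tau>) \<noteq> 0" "psi ((of_int k - z) / \<tau>) \<noteq> 0"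
proof -
  have psi_regular_minus: "- t \<in> psi_regular" if "t \<in> psi_regular" for t
    using that by (auto simp: psi_regular_def minus_in_Ints_iff)
  show "psi ((of_int k + z) / \<tau>) \<noteq> 0"
    using assms by (intro psi_nonzero) (auto simp: psi_dom_def)
  have "- ((of_int (- k) + z) / \<tau>) \<in> psi_regular"
    using assms by (intro psi_regular_minus) (auto simp: psi_dom_def simp del: of_int_minus)
  moreover have "- ((of_int (- k) + z) / \<tau>) = (of_int k - z) / \<tau>"
    by (simp add: diff_divide_distrib add_divide_distrib)
  ultimately show "psi ((of_int k - z) / \<tau>) \<noteq> 0"
    by (intro psi_nonzero) simp
qed

lemma psi_prod_add_1:
  assumes "z \<in> psi_dom \<tau>"
  shows "psi_prod \<tau> (z + 1) * e1 (1 / 12 - ((1 + z) / \<tau>) ^ 2 / 2) = psi_prod \<tau> z"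
proof -
  note nz = psi_dom_psi_nonzero[OF assms]
  have nz': "psi ((of_nat N - z) / \<tau>) \<noteq> 0" "psi ((of_nat N - (z + 1)) / \<tau>) \<noteq> 0" for N
    using nz(2)[of "int N"] nz(2)[of "int N - 1"] by (simp_all add: algebra_simps)
  \<comment> \<open>numerators and denominators telescope separately, in opposite directions\<close>
  have p: "(\<Prod>k<N. psi_factor \<tau> k (z + 1)) * (psi ((1 + z) / \<tau>) * psi (- ((1 + z) / \<tau>))) =
        (\<Prod>k<N. psi_factor \<tau> k z) * (psi ((of_nat N + (1 + z)) / \<tau>) * psi ((of_nat N + (- 1 - z)) / \<tau>))" for N
  proof (induction N)
    case 0
    then show ?case by (simp add: minus_divide_left)
  next
    case (Suc N)
    define a b c d where "a = psi ((of_nat N + (1 + z)) / \<tau>)" and "b = psi ((of_nat N - (z + 1)) / \<tau>)"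
      and "c = psi ((of_nat N + 1 + (z + 1)) / \<tau>)" and "d = psi ((of_nat N - z) / \<tau>)"
    have f: "psi_factor \<tau> N (z + 1) = c / b" "psi_factor \<tau> N z = a / d"
      by (simp_all add: psi_factor_def a_def b_def c_def d_def add.assoc)
    have g: "psi ((of_nat N + (- 1 - z)) / \<tau>) = b" "psi ((of_nat (Suc N) + (1 + z)) / \<tau>) = c"
      "psi ((of_nat (Suc N) + (- 1 - z)) / \<tau>) = d"
      by (simp_all add: b_def c_def d_def algebra_simps)
    have nz: "b \<noteq> 0" "d \<noteq> 0" using nz'[of N] by (auto simp: b_def d_def)
    define X where "X = psi ((1 + z) / \<tau>) * psi (- ((1 + z) / \<tau>))"
    define p q where "p = (\<Prod>k<N. psi_factor \<tau> k (z + 1))" and "q = (\<Prod>k<N. psi_factor \<tau> k z)"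
    have IH: "p * X = q * (a * b)"
      using Suc unfolding a_def [symmetric] g(1) X_def p_def q_def .
    have "p * (c / b) * X = (p * X) * (c / b)" by simp
    also have "\<dots> = q * (a / d) * (c * d)" unfolding IH using nz by simp
    finally show ?case
      unfolding prod.lessThan_Suc f g by (simp only: X_def p_def q_def)
  qed
  have "(\<lambda>N. (\<Prod>k<N. psi_factor \<tau> k z) * (psi ((of_nat N + (1 + z)) / \<tau>) * psi ((of_nat N + (- 1 - z)) / \<tau>)))
      \<longlonglongrightarrow> psi_prod \<tau> z * (1 * 1)"
    by (intro tendsto_mult psi_prod_LIMSEQ psi_tendsto_1)
  moreover have "(\<lambda>N. (\<Prod>k<N. psi_factor \<tau> k (z + 1)) * (psi ((1 + z) / \<tau>) * psi (- ((1 + z) / \<tau>))))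
      \<longlonglongrightarrow> psi_prod \<tau> (z + 1) * (psi ((1 + z) / \<tau>) * psi (- ((1 + z) / \<tau>)))"
    by (intro tendsto_mult psi_prod_LIMSEQ tendsto_const)
  ultimately have "psi_prod \<tau> (z + 1) * (psi ((1 + z) / \<tau>) * psi (- ((1 + z) / \<tau>))) = psi_prod \<tau> z"
    unfolding p using LIMSEQ_unique by fastforce
  moreover have "(1 + z) / \<tau> \<in> psi_regular"
    using assms unfolding psi_dom_def by (metis (mono_tags) mem_Collect_eq of_int_1)
  ultimately show ?thesis
    by (simp add: psi_reflect)
qed

lemma nonlattice_not_Ints:
  assumes "z \<notin> period_lattice \<tau>"
  shows "(of_int k + z) / \<tau> \<notin> \<int>" "(of_int k - z) / \<tau> \<notin> \<int>"
proof -
  show "(of_int k + z) / \<tau> \<notin> \<int>"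
  proof
    assume "(of_int k + z) / \<tau> \<in> \<int>"
    then obtain n :: int where "(of_int k + z) / \<tau> = of_int n" by (elim Ints_cases)
    then have "z = of_int (- k) + of_int n * \<tau>"
      using tau_nonzero by (simp add: field_simps)
    with assms show False by (blast intro: period_latticeI)
  qed
  show "(of_int k - z) / \<tau> \<notin> \<int>"
  proof
    assume "(of_int k - z) / \<tau> \<in> \<int>"
    then obtain n :: int where "(of_int k - z) / \<tau> = of_int n" by (elim Ints_cases)
    then have "z = of_int k + of_int (- n) * \<tau>"
      using tau_nonzero by (simp add: field_simps)
    with assms show False by (blast intro: period_latticeI)
  qed
qed

lemma nonlattice_psi_dom: "z \<notin> period_lattice \<tau> \<Longrightarrow> z \<in> psi_dom \<tau>"
  using nonlattice_not_Ints by (auto simp: psi_dom_def psi_regular_def)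

lemma psi_prod_add_tau:
  assumes "z \<notin> period_lattice \<tau>"
  shows "psi_prod \<tau> (z + \<tau>) = psi_prod \<tau> z * theta0 (z / \<tau>) (- 1 / \<tau>)"
proof -
  define th where "th = (\<lambda>j. (1 - exp (2 * of_real pi * \<i> * ((of_nat j + 1) * (- 1 / \<tau>) - z / \<tau>))) *
           (1 - exp (2 * of_real pi * \<i> * (of_nat j * (- 1 / \<tau>) + z / \<tau>))))"
  have "psi_factor \<tau> k (z + \<tau>) = psi_factor \<tau> k z * th k" for k
  proof -
    define s t where "s = (of_nat k + 1 + z) / \<tau>" and "t = (of_nat k - (z + \<tau>)) / \<tau>"
    have st: "s \<notin> \<int>" "t + 1 \<notin> \<int>" "t + 1 = (of_nat k - z) / \<tau>"
      "(of_nat k + 1 + (z + \<tau>)) / \<tau> = s + 1"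
      using nonlattice_not_Ints(1)[OF assms, of "int k + 1"] nonlattice_not_Ints(2)[OF assms, of "int k"] tau_nonzero
      by (simp_all add: s_def t_def field_simps)
    have "t \<notin> \<int>"
      using st(2) by (metis Ints_1 Ints_add)
    then have ne: "1 - e1 (- t) \<noteq> 0" by (simp add: e1_minus_eq_1_iff)
    have et: "e1 (- (t + 1)) = e1 (- t)"
      by (simp add: e1_add e1_diff)
    have "psi_factor \<tau> k (z + \<tau>) = psi (s + 1) / psi t"
      by (simp add: psi_factor_def st t_def)
    also have "\<dots> = psi s * (1 - e1 (- s)) / (psi (t + 1) / (1 - e1 (- t)))"
      using ne by (simp add: psi_shift[OF \<open>s \<notin> \<int>\<close>] psi_shift[OF \<open>t \<notin> \<int>\<close>])
    also have "\<dots> = psi s / psi (t + 1) * ((1 - e1 (- s)) * (1 - e1 (- (t + 1))))"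
      using ne unfolding et by simp
    also have "psi s / psi (t + 1) = psi_factor \<tau> k z"
      by (simp add: psi_factor_def st s_def)
    also have "(1 - e1 (- s)) * (1 - e1 (- (t + 1))) = th k"
      unfolding th_def e1_def st(3) s_def by (simp add: field_simps diff_divide_distrib add_divide_distrib)
    finally show ?thesis .
  qed
  then have "psi_prod \<tau> (z + \<tau>) = (\<Prod>k. psi_factor \<tau> k z * th k)"
    by (simp add: psi_prod_def)
  also have "\<dots> = psi_prod \<tau> z * (\<Prod>k. th k)"
    unfolding psi_prod_def th_def
    by (intro prodinf_mult [symmetric] convergent_prod_psi_factor convergent_prod_theta0
          Im_minus_inverse_tau)
  finally show ?thesis
    by (simp add: th_def theta0_def)
qed

end

section \<open>Functions with doubly periodic modulus\<close>

text \<open>The open parallelogram \<open>{a + b \<tau> : \<bar>a\<bar>, \<bar>b\<bar> < 1}\<close>; see \<open>period_cell_iff\<close>.  In this form the two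
  conditions say that \<open>z\<close> and \<open>z / \<tau>\<close> lie in the strips in which the theta functions with moduli \<open>\<tau>\<close>
  and \<open>-1 / \<tau>\<close> vanish only on the real axis.\<close>

definition period_cell :: "complex \<Rightarrow> complex set" where
  "period_cell \<tau> = {z. \<bar>Im z\<bar> < Im \<tau> \<and> \<bar>Im (z / \<tau>)\<bar> < Im (- 1 / \<tau>)}"

lemma open_period_cell: "open (period_cell \<tau>)"
proof -
  have "open {z. \<bar>Im z\<bar> < Im \<tau>}" "open {z. \<bar>Im (z * (1 / \<tau>))\<bar> < Im (- 1 / \<tau>)}"
    by (intro open_Collect_less continuous_intros)+
  then have "open ({z. \<bar>Im z\<bar> < Im \<tau>} \<inter> {z. \<bar>Im (z * (1 / \<tau>))\<bar> < Im (- 1 / \<tau>)})"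
    by (rule open_Int)
  moreover have "period_cell \<tau> = {z. \<bar>Im z\<bar> < Im \<tau>} \<inter> {z. \<bar>Im (z * (1 / \<tau>))\<bar> < Im (- 1 / \<tau>)}"
    by (auto simp: period_cell_def)
  ultimately show ?thesis by simp
qed

context
  fixes \<tau> :: complex
  assumes tau: "Im \<tau> > 0"
begin

lemma lattice_coords:
  obtains a b :: real where "z = of_real a + of_real b * \<tau>"
proof
  show "z = of_real (Re z - Im z / Im \<tau> * Re \<tau>) + of_real (Im z / Im \<tau>) * \<tau>"
    using tau by (simp add: complex_eq_iff)
qed

lemma period_cell_iff: "of_real a + of_real b * \<tau> \<in> period_cell \<tau> \<longleftrightarrow> \<bar>a\<bar> < 1 \<and> \<bar>b\<bar> < 1"
proof -
  have y: "Im (1 / \<tau>) < 0" by (rule Im_inverse_tau[OF tau])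
  have "(of_real a + of_real b * \<tau>) / \<tau> = of_real a * (1 / \<tau>) + of_real b"
    using tau_nonzero[OF tau] by (simp add: field_simps)
  then have "Im ((of_real a + of_real b * \<tau>) / \<tau>) = a * Im (1 / \<tau>)"
    by (simp only: plus_complex.sel times_complex.sel Re_complex_of_real Im_complex_of_real)
  then have "\<bar>Im ((of_real a + of_real b * \<tau>) / \<tau>)\<bar> = \<bar>a\<bar> * Im (- 1 / \<tau>)"
    using y by (simp add: abs_mult)
  moreover have "\<bar>Im (of_real a + of_real b * \<tau>)\<bar> = \<bar>b\<bar> * Im \<tau>"
    using tau by (simp add: abs_mult)
  ultimately show ?thesis
    using tau Im_minus_inverse_tau[OF tau] unfolding period_cell_def by auto
qed

lemma connected_period_cell: "connected (period_cell \<tau>)"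
proof -
  define h where "h = (\<lambda>p. of_real (fst p) + of_real (snd p) * \<tau>)"
  have "connected ({-1<..<1::real} \<times> {-1<..<1::real})"
    by (intro convex_connected convex_Times) auto
  then have "connected (h ` ({-1<..<1} \<times> {-1<..<1}))"
    unfolding h_def by (rule connected_continuous_image[rotated]) (intro continuous_intros)
  also have "h ` ({-1<..<1} \<times> {-1<..<1}) = period_cell \<tau>"
  proof safe
    fix a b :: real assume "a \<in> {-1<..<1}" "b \<in> {-1<..<1}"
    then show "h (a, b) \<in> period_cell \<tau>"
      by (simp add: h_def period_cell_iff abs_less_iff)
  next
    fix z assume z: "z \<in> period_cell \<tau>"
    obtain a b where ab: "z = of_real a + of_real b * \<tau>" by (rule lattice_coords)
    with z have "(a, b) \<in> {-1<..<1} \<times> {-1<..<1}"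
      by (auto simp: period_cell_iff)
    moreover have "z = h (a, b)" by (simp add: h_def ab)
    ultimately show "z \<in> h ` ({-1<..<1} \<times> {-1<..<1})" by blast
  qed
  finally show ?thesis .
qed

lemma period_cell_lattice:
  assumes "z \<in> period_cell \<tau>" "z \<in> period_lattice \<tau>"
  shows "z = 0"
proof -
  obtain m n :: int where z: "z = of_int m + of_int n * \<tau>"
    using assms(2) by (auto simp: period_lattice_def)
  then have "of_real (of_int m) + of_real (of_int n) * \<tau> \<in> period_cell \<tau>"
    using assms(1) by simp
  then have "\<bar>real_of_int m\<bar> < 1 \<and> \<bar>real_of_int n\<bar> < 1"
    unfolding period_cell_iff .
  then have "m = 0" "n = 0" by linarith+
  then show ?thesis by (simp add: z)
qed

lemma zero_in_period_cell: "0 \<in> period_cell \<tau>"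
  using period_cell_iff[of 0 0] by simp

lemma one_tau_notin_period_cell: "1 \<notin> period_cell \<tau>" "- 1 \<notin> period_cell \<tau>"
    "\<tau> \<notin> period_cell \<tau>" "- \<tau> \<notin> period_cell \<tau>"
  using period_cell_iff[of 1 0] period_cell_iff[of "-1" 0] period_cell_iff[of 0 1]
    period_cell_iff[of 0 "-1"] by simp_all

lemma period_cell_shift_nonlattice:
  assumes "z \<in> period_cell \<tau>" "z + p \<in> period_cell \<tau>" "p \<in> {1, \<tau>}"
  shows "z \<notin> period_lattice \<tau>"
  using assms period_cell_lattice[of z] one_tau_notin_period_cell by auto

lemma periodic_norm_imp_constant:
  assumes hol: "f holomorphic_on period_cell \<tau>"
    and 1: "\<And>z. z \<in> period_cell \<tau> \<Longrightarrow> z + 1 \<in> period_cell \<tau> \<Longrightarrow> norm (f (z + 1)) = norm (f z)"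
    and t: "\<And>z. z \<in> period_cell \<tau> \<Longrightarrow> z + \<tau> \<in> period_cell \<tau> \<Longrightarrow> norm (f (z + \<tau>)) = norm (f z)"
  obtains c where "\<And>z. z \<in> period_cell \<tau> \<Longrightarrow> f z = c"
proof -
  define h where "h = (\<lambda>p. of_real (fst p) + of_real (snd p) * \<tau>)"
  define I where "I = {-1/2..1/2 :: real}"
  have h: "h (a, b) \<in> period_cell \<tau> \<longleftrightarrow> \<bar>a\<bar> < 1 \<and> \<bar>b\<bar> < 1" for a b
    by (simp add: h_def period_cell_iff)
  have h1: "h (a, b) = h (a - 1, b) + 1" for a b by (simp add: h_def)
  have ht: "h (a, b) = h (a, b - 1) + \<tau>" for a b by (simp add: h_def algebra_simps)
  define K where "K = h ` (I \<times> I)"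
  have K: "K \<subseteq> period_cell \<tau>" by (auto simp: K_def I_def h)
  have "compact K"
    unfolding K_def h_def I_def
    by (intro compact_continuous_image continuous_intros compact_Times compact_Icc)
  moreover have "K \<noteq> {}" by (auto simp: K_def I_def)
  moreover have "continuous_on K (\<lambda>z. norm (f z))"
    by (rule continuous_on_norm[OF holomorphic_on_imp_continuous_on[OF holomorphic_on_subset[OF hol K]]])
  ultimately obtain w where w: "w \<in> K" "\<And>z. z \<in> K \<Longrightarrow> norm (f z) \<le> norm (f w)"
    using continuous_attains_sup by metis
  \<comment> \<open>translate each coordinate back into \<open>[-1/2, 1/2]\<close> without leaving the parallelogram\<close>
  have red1: "\<exists>a'\<in>I. norm (f (h (a, b))) = norm (f (h (a', b)))" if "\<bar>a\<bar> < 1" "\<bar>b\<bar> < 1" for a b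
  proof -
    consider "a \<in> I" | "a > 1/2" | "a < - 1/2" by (force simp: I_def)
    then show ?thesis
    proof cases
      case 2
      then have "norm (f (h (a, b))) = norm (f (h (a - 1, b)))"
        using that 1[of "h (a - 1, b)"] h[of "a - 1" b] h[of a b] h1[of a b] by simp
      then show ?thesis using 2 that by (intro bexI[of _ "a - 1"]) (auto simp: I_def)
    next
      case 3
      then have "norm (f (h (a + 1, b))) = norm (f (h (a, b)))"
        using that 1[of "h (a, b)"] h[of "a + 1" b] h[of a b] h1[of "a + 1" b] by simp
      then show ?thesis using 3 that by (intro bexI[of _ "a + 1"]) (auto simp: I_def)
    qed auto
  qed
  have redt: "\<exists>b'\<in>I. norm (f (h (a, b))) = norm (f (h (a, b')))" if "\<bar>a\<bar> < 1" "\<bar>b\<bar> < 1" for a b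
  proof -
    consider "b \<in> I" | "b > 1/2" | "b < - 1/2" by (force simp: I_def)
    then show ?thesis
    proof cases
      case 2
      then have "norm (f (h (a, b))) = norm (f (h (a, b - 1)))"
        using that t[of "h (a, b - 1)"] h[of a "b - 1"] h[of a b] ht[of a b] by simp
      then show ?thesis using 2 that by (intro bexI[of _ "b - 1"]) (auto simp: I_def)
    next
      case 3
      then have "norm (f (h (a, b + 1))) = norm (f (h (a, b)))"
        using that t[of "h (a, b)"] h[of a "b + 1"] h[of a b] ht[of a "b + 1"] by simp
      then show ?thesis using 3 that by (intro bexI[of _ "b + 1"]) (auto simp: I_def)
    qed auto
  qed
  have "norm (f z) \<le> norm (f w)" if z: "z \<in> period_cell \<tau>" for z
  proof -
    obtain a b where "z = of_real a + of_real b * \<tau>" by (rule lattice_coords)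
    then have ab: "z = h (a, b)" by (simp add: h_def)
    with z h have lt: "\<bar>a\<bar> < 1" "\<bar>b\<bar> < 1" by auto
    obtain a' where a': "a' \<in> I" "norm (f (h (a, b))) = norm (f (h (a', b)))"
      using red1[OF lt] by blast
    then have "\<bar>a'\<bar> < 1" by (auto simp: I_def)
    then obtain b' where b': "b' \<in> I" "norm (f (h (a', b))) = norm (f (h (a', b')))"
      using redt lt(2) by blast
    have "h (a', b') \<in> K" using a' b' by (auto simp: K_def)
    then show ?thesis using w(2) a' b' ab by simp
  qed
  then have "f constant_on period_cell \<tau>"
    using w(1) K
    by (intro maximum_modulus_principle[OF hol open_period_cell connected_period_cell open_period_cell]) auto
  then show thesis using that by (auto simp: constant_on_def)
qed

text \<open>A property that is invariant under both periods need only be verified on the parallelogram.\<close>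

lemma nonlattice_induct:
  assumes z: "z \<notin> period_lattice \<tau>"
    and cell: "\<And>w. w \<in> period_cell \<tau> \<Longrightarrow> w \<notin> period_lattice \<tau> \<Longrightarrow> P w"
    and 1: "\<And>w. w \<notin> period_lattice \<tau> \<Longrightarrow> P (w + 1) \<longleftrightarrow> P w"
    and t: "\<And>w. w \<notin> period_lattice \<tau> \<Longrightarrow> P (w + \<tau>) \<longleftrightarrow> P w"
  shows "P z"
proof -
  have shift: "P (w + of_int k * p) \<and> w + of_int k * p \<notin> period_lattice \<tau>"
    if w: "w \<notin> period_lattice \<tau>" "P w"
      and p: "\<And>w. w + p \<in> period_lattice \<tau> \<longleftrightarrow> w \<in> period_lattice \<tau>"
        "\<And>w. w \<notin> period_lattice \<tau> \<Longrightarrow> P (w + p) \<longleftrightarrow> P w" for w p k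
  proof (induction k rule: int_induct[of _ 0])
    case base
    then show ?case using w by simp
  next
    case (step1 i)
    have "w + of_int (i + 1) * p = (w + of_int i * p) + p" by (simp add: algebra_simps)
    then show ?case using step1 p by metis
  next
    case (step2 i)
    have e: "w + of_int i * p = (w + of_int (i - 1) * p) + p" by (simp add: algebra_simps)
    then have "w + of_int (i - 1) * p \<notin> period_lattice \<tau>" using step2 p by metis
    then show ?case using step2 p e by metis
  qed
  obtain a b where ab: "z = of_real a + of_real b * \<tau>" by (rule lattice_coords)
  define w where "w = of_real (frac a) + of_real (frac b) * \<tau>"
  have zw: "z = (w + of_int \<lfloor>a\<rfloor> * 1) + of_int \<lfloor>b\<rfloor> * \<tau>"
    by (simp add: w_def ab frac_def algebra_simps)
  have wL: "w \<notin> period_lattice \<tau>"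
  proof
    assume "w \<in> period_lattice \<tau>"
    then obtain m n :: int where "w = of_int m + of_int n * \<tau>" by (auto simp: period_lattice_def)
    then have "z = of_int (m + \<lfloor>a\<rfloor>) + of_int (n + \<lfloor>b\<rfloor>) * \<tau>"
      by (simp add: zw algebra_simps)
    with z show False by (blast intro: period_latticeI)
  qed
  have "w \<in> period_cell \<tau>"
    unfolding w_def period_cell_iff by (simp add: frac_lt_1)
  then have Pw: "P w" using wL by (rule cell)
  have s1: "P (w + of_int \<lfloor>a\<rfloor> * 1)" "w + of_int \<lfloor>a\<rfloor> * 1 \<notin> period_lattice \<tau>"
    using shift[OF wL Pw period_lattice_add_1 1] by auto
  show ?thesis
    unfolding zw using shift[OF s1(2,1) period_lattice_add_tau t] by auto
qed

end

section \<open>Theta functions at the half periods\<close>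

lemma qpoch_mult_minus:
  assumes "norm q < 1"
  shows "qpoch q y * qpoch q (- y) = qpoch (q ^ 2) (y ^ 2)"
proof -
  have "qpoch q y * qpoch q (- y) = (\<Prod>k. (1 - y * q ^ k) * (1 - (- y) * q ^ k))"
    unfolding qpoch_def by (intro prodinf_mult convergent_prod_qpoch assms)
  also have "(\<lambda>k. (1 - y * q ^ k) * (1 - (- y) * q ^ k)) = (\<lambda>k. 1 - y ^ 2 * (q ^ 2) ^ k)"
    by (simp add: fun_eq_iff algebra_simps power2_eq_square power_mult_distrib)
  finally show ?thesis by (simp add: qpoch_def)
qed

lemma qpoch_even_odd:
  assumes "norm q < 1"
  shows "qpoch q y = qpoch (q ^ 2) y * qpoch (q ^ 2) (q * y)"
proof -
  have q2: "norm (q ^ 2) < 1"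
    using assms by (simp add: norm_power power_less_one_iff abs_square_less_1)
  have "(\<Prod>k<2*N. 1 - y * q ^ k) = (\<Prod>k<N. 1 - y * (q ^ 2) ^ k) * (\<Prod>k<N. 1 - (q * y) * (q ^ 2) ^ k)" for N
    by (induction N) (simp_all add: power_mult power_mult_distrib mult_ac power2_eq_square)
  moreover have "(\<lambda>N. \<Prod>k<2*N. 1 - y * q ^ k) \<longlonglongrightarrow> qpoch q y"
  proof -
    have "strict_mono (\<lambda>N::nat. 2 * N)" by (simp add: strict_mono_def)
    then show ?thesis
      using LIMSEQ_subseq_LIMSEQ[OF convergent_prod_LIMSEQ_lessThan[OF convergent_prod_qpoch[OF assms, of y]]]
      unfolding qpoch_def by (simp add: o_def)
  qed
  moreover have "(\<lambda>N. (\<Prod>k<N. 1 - y * (q ^ 2) ^ k) * (\<Prod>k<N. 1 - (q * y) * (q ^ 2) ^ k)) \<longlonglongrightarrow>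
      qpoch (q ^ 2) y * qpoch (q ^ 2) (q * y)"
    unfolding qpoch_def
    by (intro tendsto_mult convergent_prod_LIMSEQ_lessThan convergent_prod_qpoch q2)
  ultimately show ?thesis
    using LIMSEQ_unique by fastforce
qed

text \<open>Euler's identity; after multiplication by \<open>(q; q)\<^sub>\<infinity>\<close> it amounts to splitting that product into its
  even and odd factors.\<close>

lemma qpoch_Euler:
  assumes "norm q < 1" "p ^ 2 = q"
  shows "qpoch q (- q) * (qpoch q p * qpoch q (- p)) = 1"
proof -
  have "qpoch q q \<noteq> 0" using assms by (intro qpoch_nonzero') auto
  moreover have "qpoch q q * (qpoch q (- q) * (qpoch q p * qpoch q (- p))) = qpoch q q"
    using qpoch_mult_minus[OF assms(1), of q] qpoch_mult_minus[OF assms(1), of p]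
      qpoch_even_odd[OF assms(1), of q] assms(2) by (simp add: power2_eq_square mult_ac)
  ultimately show ?thesis by simp
qed

lemma e1_half: "e1 (1 / 2) = - 1"
  by (simp add: e1_def)

lemma theta0_half_periods:
  assumes "Im \<tau> > 0"
  shows "theta0 (1 / 2) \<tau> * theta0 (\<tau> / 2) \<tau> * theta0 (1 / 2 + \<tau> / 2) \<tau> = 2"
proof -
  define q p where "q = e1 \<tau>" and "p = e1 (\<tau> / 2)"
  have q: "norm q < 1" using assms by (simp add: q_def norm_e1_less_1)
  have pq: "p ^ 2 = q" by (simp add: p_def q_def power2_eq_square flip: e1_add)
  have half: "e1 (\<tau> - 1 / 2) = - q" by (simp add: e1_diff e1_half q_def)
  have "\<tau> - \<tau> / 2 = \<tau> / 2" "\<tau> - (1 / 2 + \<tau> / 2) = \<tau> / 2 - 1 / 2" by (simp_all add: field_simps)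
  then have e: "e1 (\<tau> - \<tau> / 2) = p" "e1 (\<tau> - (1 / 2 + \<tau> / 2)) = - p" "e1 (1 / 2 + \<tau> / 2) = - p"
    by (simp_all only: e1_diff e1_add e1_half p_def) simp_all
  have "qpoch q (- 1) = 2 * qpoch q (- q)"
    by (subst qpoch_rec[OF q]) simp
  then have "theta0 (1 / 2) \<tau> * theta0 (\<tau> / 2) \<tau> * theta0 (1 / 2 + \<tau> / 2) \<tau> =
      2 * (qpoch q (- q) * (qpoch q p * qpoch q (- p))) ^ 2"
    unfolding theta0_eq[OF assms] half e e1_half q_def [symmetric] p_def [symmetric]
    by (simp add: power2_eq_square)
  then show ?thesis by (simp add: qpoch_Euler[OF q pq])
qed

section \<open>The modular transformation of the theta function\<close>

text \<open>The quadratic polynomial \<open>B\<close> in the transformation law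
  \<open>\<theta>\<^sub>0(z/\<tau>, -1/\<tau>) = exp(\<pi> \<i> B(z)) \<theta>\<^sub>0(z, \<tau>)\<close>.\<close>

definition theta_exponent :: "complex \<Rightarrow> complex \<Rightarrow> complex" where
  "theta_exponent \<tau> z = z ^ 2 / \<tau> + z * (1 / \<tau> - 1) + (\<tau> + 1 / \<tau>) / 6 - 1 / 2"

text \<open>The quotient of the two sides of that law; the law states that it is \<open>1\<close>.\<close>

definition theta_quotient :: "complex \<Rightarrow> complex \<Rightarrow> complex" where
  "theta_quotient \<tau> z = e1 (- theta_exponent \<tau> z / 2) * theta0 (z / \<tau>) (- 1 / \<tau>) / theta0 z \<tau>"

text \<open>The function \<open>\<theta>\<^sub>0(z, \<tau>)\<close> without the factor \<open>1 - e(z)\<close> that is responsible for its zeros on the real axis.\<close>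

definition theta_core :: "complex \<Rightarrow> complex \<Rightarrow> complex" where
  "theta_core \<tau> z = qpoch (e1 \<tau>) (e1 (\<tau> - z)) * qpoch (e1 \<tau>) (e1 (\<tau> + z))"

text \<open>The expression that represents \<open>\<Gamma>(z + \<tau>, \<tau>, \<tau>)\<close>.  The argument is shifted by \<open>\<tau>\<close> because this
  function is regular at \<open>z = 0\<close>, unlike its translate by \<open>-\<tau>\<close>.\<close>

definition gamma_numerator :: "complex \<Rightarrow> complex \<Rightarrow> complex" where
  "gamma_numerator \<tau> z = e1 (- Q (z + \<tau>) \<tau> \<tau> / 2) * psi_prod \<tau> z"

lemma theta0_eq_core:
  assumes "Im \<tau> > 0"
  shows "theta0 z \<tau> = (1 - e1 z) * theta_core \<tau> z"
  unfolding theta0_eq[OF assms] theta_core_def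
  by (subst (2) qpoch_rec[OF norm_e1_tau[OF assms]]) (simp add: e1_add mult_ac)

context
  fixes \<tau> :: complex
  assumes tau: "Im \<tau> > 0"
begin

lemma theta_core_nonzero:
  assumes "\<bar>Im z\<bar> < Im \<tau>"
  shows "theta_core \<tau> z \<noteq> 0"
  unfolding theta_core_def using assms
  by (auto simp: qpoch_nonzero'[OF norm_e1_tau[OF tau]] norm_e1_less_1)

lemma holomorphic_theta_core:
  "f holomorphic_on S \<Longrightarrow> (\<lambda>z. theta_core \<tau> (f z)) holomorphic_on S"
  unfolding theta_core_def
  by (intro holomorphic_intros holomorphic_qpoch_comp norm_e1_tau tau)

lemma theta_exponent_add_1:
  "theta_exponent \<tau> (z + 1) = theta_exponent \<tau> z + 2 * (z + 1) / \<tau> - 1"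
  using tau_nonzero[OF tau] by (simp add: theta_exponent_def field_simps power2_eq_square)

lemma theta_exponent_add_tau:
  "theta_exponent \<tau> (z + \<tau>) = theta_exponent \<tau> z + 2 * z + 1"
  using tau_nonzero[OF tau] by (simp add: theta_exponent_def field_simps power2_eq_square)

lemma theta_quotient_add_1:
  assumes "z \<notin> period_lattice \<tau>"
  shows "theta_quotient \<tau> (z + 1) = theta_quotient \<tau> z"
proof -
  define w where "w = (z + 1) / \<tau>"
  have w: "w \<notin> period_lattice (- 1 / \<tau>)"
    unfolding w_def using assms
    by (simp only: period_lattice_mult_modulus[OF tau_nonzero[OF tau]] period_lattice_add_1 not_False_eq_True)
  have "z / \<tau> = w + - 1 / \<tau>" by (simp add: w_def add_divide_distrib)
  then have th: "theta0 (z / \<tau>) (- 1 / \<tau>) = - theta0 w (- 1 / \<tau>) / e1 w"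
    using theta0_add_tau[OF Im_minus_inverse_tau[OF tau] w] by simp
  have "- theta_exponent \<tau> (z + 1) / 2 = - theta_exponent \<tau> z / 2 - w + 1 / 2"
    unfolding theta_exponent_add_1 by (simp add: w_def field_simps)
  then have "e1 (- theta_exponent \<tau> (z + 1) / 2) = - (e1 (- theta_exponent \<tau> z / 2) / e1 w)"
    by (simp only: e1_add e1_diff e1_half) simp
  then show ?thesis
    unfolding theta_quotient_def th w_def [symmetric] theta0_add_1[OF tau] by simp
qed

lemma theta_quotient_add_tau:
  assumes "z \<notin> period_lattice \<tau>"
  shows "theta_quotient \<tau> (z + \<tau>) = theta_quotient \<tau> z"
proof -
  have "(z + \<tau>) / \<tau> = z / \<tau> + 1"
    using tau_nonzero[OF tau] by (simp add: field_simps)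
  then have th: "theta0 ((z + \<tau>) / \<tau>) (- 1 / \<tau>) = theta0 (z / \<tau>) (- 1 / \<tau>)"
    by (simp only: theta0_add_1[OF Im_minus_inverse_tau[OF tau]])
  have "- theta_exponent \<tau> (z + \<tau>) / 2 = - theta_exponent \<tau> z / 2 - (z + 1 / 2)"
    unfolding theta_exponent_add_tau by (simp add: field_simps)
  then have "e1 (- theta_exponent \<tau> (z + \<tau>) / 2) = - (e1 (- theta_exponent \<tau> z / 2) / e1 z)"
    by (simp only: e1_add e1_diff e1_half) simp
  then show ?thesis
    unfolding theta_quotient_def th theta0_add_tau[OF tau assms] by simp
qed

lemma theta_quotient_constant_on_cell:
  obtains c where "\<And>z. z \<in> period_cell \<tau> \<Longrightarrow> z \<noteq> 0 \<Longrightarrow> theta_quotient \<tau> z = c"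
proof -
  note tau' = Im_minus_inverse_tau[OF tau]
  have t0: "\<tau> \<noteq> 0" by (rule tau_nonzero[OF tau])
  define r where "r = (\<lambda>z. if z = 0 then 1 / \<tau> else (1 - e1 (z / \<tau>)) / (1 - e1 z))"
  define g where "g = (\<lambda>z. e1 (- theta_exponent \<tau> z / 2) * theta_core (- 1 / \<tau>) (z / \<tau>) / theta_core \<tau> z)"
  have cell: "\<bar>Im z\<bar> < Im \<tau>" if "z \<in> period_cell \<tau>" for z
    using that by (simp add: period_cell_def)
  have "(\<lambda>z. theta_core (- 1 / \<tau>) (z / \<tau>)) holomorphic_on period_cell \<tau>"
  proof -
    have "(\<lambda>z. z / \<tau>) holomorphic_on period_cell \<tau>" using t0 by (intro holomorphic_intros)
    then show ?thesis
      unfolding theta_core_def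
      by (intro holomorphic_intros holomorphic_qpoch_comp norm_e1_tau tau') (simp_all add: t0)
  qed
  then have hg: "g holomorphic_on period_cell \<tau>"
    unfolding g_def theta_exponent_def
    using t0 theta_core_nonzero[OF cell]
    by (intro holomorphic_on_divide holomorphic_on_mult holomorphic_theta_core holomorphic_on_e1)
       (auto intro!: holomorphic_intros simp: t0)
  have hr: "r holomorphic_on period_cell \<tau>"
    unfolding r_def
  proof (rule removable_singularity[OF _ open_period_cell])
    have "e1 z \<noteq> 1" if "z \<in> period_cell \<tau> - {0}" for z
    proof
      assume "e1 z = 1"
      then obtain m where "z = of_int m" unfolding e1_eq_1_iff by (elim Ints_cases)
      then have "z \<in> period_lattice \<tau>" by (intro period_latticeI[of _ m 0]) simp
      then show False using that period_cell_lattice[OF tau] by blast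
    qed
    then show "(\<lambda>z. (1 - e1 (z / \<tau>)) / (1 - e1 z)) holomorphic_on period_cell \<tau> - {0}"
      using t0 by (auto intro!: holomorphic_intros)
    have D: "((\<lambda>z. 1 - e1 (z / \<tau>)) has_field_derivative - (2 * of_real pi * \<i> / \<tau>)) (at 0)"
      using t0 by (auto intro!: derivative_eq_intros)
    then have "((\<lambda>z. (1 - e1 (z / \<tau>)) / z) \<longlongrightarrow> - (2 * of_real pi * \<i> / \<tau>)) (at 0)"
      by (simp add: has_field_derivative_iff)
    moreover have "((\<lambda>z. (1 - e1 z) / z) \<longlongrightarrow> - (2 * of_real pi * \<i>)) (at 0)"
      using tendsto_minus[OF tendsto_e1_minus_1] by (simp add: minus_divide_left)
    ultimately have "((\<lambda>z. ((1 - e1 (z / \<tau>)) / z) / ((1 - e1 z) / z)) \<longlongrightarrow>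
        - (2 * of_real pi * \<i> / \<tau>) / - (2 * of_real pi * \<i>)) (at 0)"
      by (rule tendsto_divide) simp
    also have "- (2 * of_real pi * \<i> / \<tau>) / - (2 * of_real pi * \<i>) = 1 / \<tau>"
      using t0 by (simp add: field_simps)
    finally show "(\<lambda>z. (1 - e1 (z / \<tau>)) / (1 - e1 z)) \<midarrow>0\<rightarrow> 1 / \<tau>"
      by (rule Lim_transform_eventually) (auto simp: eventually_at_filter)
  qed
  have eq: "r z * g z = theta_quotient \<tau> z" if "z \<noteq> 0" for z
    unfolding theta_quotient_def theta0_eq_core[OF tau] theta0_eq_core[OF tau'] r_def g_def
    using that by simp
  have "norm (r (z + 1) * g (z + 1)) = norm (r z * g z)"
    if "z \<in> period_cell \<tau>" "z + 1 \<in> period_cell \<tau>" for z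
  proof -
    have "z \<noteq> 0" "z + 1 \<noteq> 0" using that one_tau_notin_period_cell[OF tau]
      by (auto simp: add_eq_0_iff2)
    then show ?thesis
      using eq theta_quotient_add_1 period_cell_shift_nonlattice[OF tau that] by simp
  qed
  moreover have "norm (r (z + \<tau>) * g (z + \<tau>)) = norm (r z * g z)"
    if "z \<in> period_cell \<tau>" "z + \<tau> \<in> period_cell \<tau>" for z
  proof -
    have "z \<noteq> 0" "z + \<tau> \<noteq> 0" using that one_tau_notin_period_cell[OF tau]
      by (auto simp: add_eq_0_iff2)
    then show ?thesis
      using eq theta_quotient_add_tau period_cell_shift_nonlattice[OF tau that] by simp
  qed
  moreover have "(\<lambda>z. r z * g z) holomorphic_on period_cell \<tau>"
    using hr hg by (rule holomorphic_on_mult)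
  ultimately obtain c where "\<And>z. z \<in> period_cell \<tau> \<Longrightarrow> r z * g z = c"
    using periodic_norm_imp_constant[OF tau, of "\<lambda>z. r z * g z"] by blast
  then show thesis using eq that by metis
qed

text \<open>Only \<open>\<bar>c\<bar> = 1\<close> is recorded: with \<open>c\<^sup>3 = 1\<close> the cube root of unity itself is not yet determined.\<close>

lemma theta_quotient_constant:
  obtains c where "norm c = 1" "\<And>z. z \<notin> period_lattice \<tau> \<Longrightarrow> theta_quotient \<tau> z = c"
proof -
  note tau' = Im_minus_inverse_tau[OF tau]
  have t0: "\<tau> \<noteq> 0" by (rule tau_nonzero[OF tau])
  obtain c where c: "\<And>z. z \<in> period_cell \<tau> \<Longrightarrow> z \<noteq> 0 \<Longrightarrow> theta_quotient \<tau> z = c"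
    using theta_quotient_constant_on_cell by blast
  have zero: "0 \<in> period_lattice \<tau>" by (rule period_latticeI[of _ 0 0]) simp
  have all: "theta_quotient \<tau> z = c" if "z \<notin> period_lattice \<tau>" for z
    using that
  proof (rule nonlattice_induct[OF tau])
    fix w assume "w \<in> period_cell \<tau>" "w \<notin> period_lattice \<tau>"
    then show "theta_quotient \<tau> w = c" using c zero by metis
  qed (simp_all add: theta_quotient_add_1 theta_quotient_add_tau)
  \<comment> \<open>the three nonzero half periods, represented so that division by \<open>\<tau>\<close> turns them into
    half periods for the modulus \<open>-1 / \<tau>\<close>\<close>
  define a b d where "a = - 1 / (2 :: complex)" and "b = \<tau> / 2" and "d = (\<tau> - 1) / 2"
  have in_cell: "a \<in> period_cell \<tau>" "b \<in> period_cell \<tau>" "d \<in> period_cell \<tau>"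
    using period_cell_iff[OF tau, of "-1/2" 0] period_cell_iff[OF tau, of 0 "1/2"]
      period_cell_iff[OF tau, of "-1/2" "1/2"]
    by (simp_all add: a_def b_def d_def diff_divide_distrib)
  have "a \<noteq> 0" "b \<noteq> 0" "d \<noteq> 0" using tau t0 by (auto simp: a_def b_def d_def)
  with in_cell c have abd: "theta_quotient \<tau> a = c" "theta_quotient \<tau> b = c" "theta_quotient \<tau> d = c"
    by auto
  define N D where "N = theta0 (a / \<tau>) (- 1 / \<tau>) * theta0 (b / \<tau>) (- 1 / \<tau>) * theta0 (d / \<tau>) (- 1 / \<tau>)"
    and "D = theta0 a \<tau> * theta0 b \<tau> * theta0 d \<tau>"
  have "theta_exponent \<tau> a + theta_exponent \<tau> b + theta_exponent \<tau> d = 0"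
    using t0 by (simp add: theta_exponent_def a_def b_def d_def field_simps power2_eq_square)
  moreover have "- theta_exponent \<tau> a / 2 + - theta_exponent \<tau> b / 2 + - theta_exponent \<tau> d / 2 =
      - (theta_exponent \<tau> a + theta_exponent \<tau> b + theta_exponent \<tau> d) / 2"
    by (simp add: field_simps)
  ultimately have ex: "- theta_exponent \<tau> a / 2 + - theta_exponent \<tau> b / 2 + - theta_exponent \<tau> d / 2 = 0"
    by simp
  have "c ^ 3 = theta_quotient \<tau> a * theta_quotient \<tau> b * theta_quotient \<tau> d"
    unfolding abd by (simp add: power3_eq_cube)
  also have "\<dots> = e1 (- theta_exponent \<tau> a / 2 + - theta_exponent \<tau> b / 2 + - theta_exponent \<tau> d / 2) * (N / D)"
    unfolding theta_quotient_def N_def D_def e1_add by simp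
  also have "\<dots> = N / D" unfolding ex by simp
  also have "D = 2"
  proof -
    have "a = 1 / 2 - 1" "d = (1 / 2 + \<tau> / 2) - 1" by (simp_all add: a_def d_def field_simps)
    then show ?thesis
      unfolding D_def b_def using theta0_half_periods[OF tau] by (simp only: theta0_minus_1[OF tau])
  qed
  also have "N = 2"
  proof -
    have "a / \<tau> = (- 1 / \<tau>) / 2" "b / \<tau> = 1 / 2" "d / \<tau> = 1 / 2 + (- 1 / \<tau>) / 2"
      using t0 by (simp_all add: a_def b_def d_def field_simps)
    then show ?thesis
      unfolding N_def using theta0_half_periods[OF tau'] by (simp only: mult_ac)
  qed
  finally have "norm c ^ 3 = 1" by (simp flip: norm_power)
  then have "norm c = 1" using power_eq_imp_eq_base[of "norm c" 3 1] by simp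
  then show thesis using all by (rule that)
qed

section \<open>Comparison with the elliptic gamma function\<close>

lemma Q_add_1: "Q (z + \<tau> + 1) \<tau> \<tau> = Q (z + \<tau>) \<tau> \<tau> + ((1 + z) / \<tau>) ^ 2 - 1 / 6"
  using tau_nonzero[OF tau] by (simp add: Q_def field_simps power2_eq_square power3_eq_cube)

lemma Q_add_tau: "Q (z + \<tau> + \<tau>) \<tau> \<tau> = Q (z + \<tau>) \<tau> \<tau> + theta_exponent \<tau> z + 2 * z + 1"
  using tau_nonzero[OF tau]
  by (simp add: Q_def theta_exponent_def field_simps power2_eq_square power3_eq_cube)

lemma Q_tau: "Q \<tau> \<tau> \<tau> = - 1 / 12"
  using tau_nonzero[OF tau] by (simp add: Q_def field_simps power2_eq_square power3_eq_cube)

lemma gamma_numerator_add_1: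
  assumes "z \<in> psi_dom \<tau>"
  shows "gamma_numerator \<tau> (z + 1) = gamma_numerator \<tau> z"
proof -
  define s where "s = ((1 + z) / \<tau>) ^ 2"
  have "z + 1 + \<tau> = z + \<tau> + 1" by simp
  then have "- Q (z + 1 + \<tau>) \<tau> \<tau> / 2 = - Q (z + \<tau>) \<tau> \<tau> / 2 + (1 / 12 - s / 2)"
    by (simp only: Q_add_1 s_def [symmetric]) (simp add: field_simps)
  then have e: "e1 (- Q (z + 1 + \<tau>) \<tau> \<tau> / 2) = e1 (- Q (z + \<tau>) \<tau> \<tau> / 2) * e1 (1 / 12 - s / 2)"
    by (simp only: e1_add)
  have p: "psi_prod \<tau> z = psi_prod \<tau> (z + 1) * e1 (1 / 12 - s / 2)"
    using psi_prod_add_1[OF tau assms] by (simp only: s_def)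
  show ?thesis
    unfolding gamma_numerator_def e p by simp
qed

lemma gamma_numerator_add_tau:
  assumes "z \<notin> period_lattice \<tau>"
  shows "gamma_numerator \<tau> (z + \<tau>) = theta_quotient \<tau> z * theta0 (z + \<tau>) \<tau> * gamma_numerator \<tau> z"
proof -
  define B where "B = theta_exponent \<tau> z"
  have "- Q (z + \<tau> + \<tau>) \<tau> \<tau> / 2 = - Q (z + \<tau>) \<tau> \<tau> / 2 + (- B / 2) - (z + 1 / 2)"
    unfolding Q_add_tau B_def by (simp add: field_simps)
  then have "e1 (- Q (z + \<tau> + \<tau>) \<tau> \<tau> / 2) = - (e1 (- Q (z + \<tau>) \<tau> \<tau> / 2) * e1 (- B / 2) / e1 z)"
    by (simp only: e1_add e1_diff e1_half) simp
  then show ?thesis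
    unfolding gamma_numerator_def theta_quotient_def psi_prod_add_tau[OF tau assms]
      theta0_add_tau[OF tau assms] B_def
    using theta0_nonzero[OF tau assms] by simp
qed

lemma period_cell_psi_dom:
  assumes "z \<in> period_cell \<tau>"
  shows "z \<in> psi_dom \<tau>"
proof (cases "z = 0")
  case True
  have "of_int k / \<tau> \<in> psi_regular" for k
  proof (cases "k = 0")
    case False
    have "of_int k / \<tau> = of_real (of_int k) * (1 / \<tau>)" by simp
    then have "Im (of_int k / \<tau>) = of_int k * Im (1 / \<tau>)"
      by (simp only: times_complex.sel Re_complex_of_real Im_complex_of_real)
    then show ?thesis
      using False Im_inverse_tau[OF tau] by (intro psi_regularI) auto
  qed (simp add: psi_regular_def)
  then show ?thesis using True by (simp add: psi_dom_def)
next
  case False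
  then have "z \<notin> period_lattice \<tau>" using assms period_cell_lattice[OF tau] by blast
  then show ?thesis by (rule nonlattice_psi_dom[OF tau])
qed

lemma holomorphic_psi_prod: "psi_prod \<tau> holomorphic_on period_cell \<tau>"
proof -
  have psi_regular: "(of_nat k + 1 + z) / \<tau> \<in> psi_regular" "(of_nat k - z) / \<tau> \<in> psi_regular" if "z \<in> period_cell \<tau>" for k z
  proof -
    have z: "z \<in> psi_dom \<tau>" by (rule period_cell_psi_dom[OF that])
    have "(of_int (int k + 1) + z) / \<tau> \<in> psi_regular"
      using z unfolding psi_dom_def by blast
    then show "(of_nat k + 1 + z) / \<tau> \<in> psi_regular" by simp
    have "(of_int (- int k) + z) / \<tau> \<in> psi_regular"
      using z unfolding psi_dom_def by blast
    then have "- ((of_int (- int k) + z) / \<tau>) \<in> psi_regular"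
      by (auto simp: psi_regular_def minus_in_Ints_iff)
    moreover have "- ((of_int (- int k) + z) / \<tau>) = (of_nat k - z) / \<tau>"
      by (simp add: diff_divide_distrib add_divide_distrib)
    ultimately show "(of_nat k - z) / \<tau> \<in> psi_regular" by simp
  qed
  have "psi_factor \<tau> k holomorphic_on period_cell \<tau>" for k
    unfolding psi_factor_def [abs_def]
    using psi_regular psi_nonzero tau_nonzero[OF tau] by (intro holomorphic_intros) auto
  moreover have "locally_dominated_product (psi_factor \<tau>) (period_cell \<tau>)"
    using locally_dominated_psi_factor[OF tau] by (simp add: locally_dominated_product_def)
  ultimately show ?thesis
    unfolding psi_prod_def [abs_def] by (intro holomorphic_prodinf open_period_cell)
qed

lemma ell_Gamma_eq_numerator:
  assumes "z \<notin> period_lattice \<tau>"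
  shows "ell_Gamma (z + \<tau>) \<tau> \<tau> = gamma_numerator \<tau> z"
proof -
  obtain c where c: "norm c = 1" "\<And>z. z \<notin> period_lattice \<tau> \<Longrightarrow> theta_quotient \<tau> z = c"
    using theta_quotient_constant by blast
  define H where "H = (\<lambda>z. gamma_numerator \<tau> z / ell_Gamma (z + \<tau>) \<tau> \<tau>)"
  have Gam: "ell_Gamma (z + \<tau>) \<tau> \<tau> = qpoch2 (e1 \<tau>) (e1 (\<tau> - z)) / qpoch2 (e1 \<tau>) (e1 (\<tau> + z))" for z
    by (simp add: ell_Gamma_eq[OF tau] add_ac)
  have Gam_nz: "qpoch2 (e1 \<tau>) (e1 (\<tau> - z)) \<noteq> 0" "qpoch2 (e1 \<tau>) (e1 (\<tau> + z)) \<noteq> 0"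
    if "z \<in> period_cell \<tau>" for z
    by (rule qpoch2_nonzero[OF norm_e1_tau[OF tau] norm_e1_less_1],
        use that in \<open>force simp: period_cell_def\<close>)+
  have H_1: "H (z + 1) = H z" if "z \<in> period_cell \<tau>" for z
    using gamma_numerator_add_1[OF period_cell_psi_dom[OF that]] ell_Gamma_add_1[OF tau, of "z + \<tau>"]
    by (simp add: H_def add_ac)
  have H_tau: "H (z + \<tau>) = c * H z" if "z \<notin> period_lattice \<tau>" for z
  proof -
    have z: "z + \<tau> \<notin> period_lattice \<tau>" using that by (simp add: period_lattice_add_tau)
    show ?thesis
      unfolding H_def gamma_numerator_add_tau[OF that] c(2)[OF that] ell_Gamma_add_tau[OF tau z]
      using theta0_nonzero[OF tau z] by simp
  qed
  have H_eq: "H = (\<lambda>z. e1 (- Q (z + \<tau>) \<tau> \<tau> / 2) * psi_prod \<tau> z *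
      qpoch2 (e1 \<tau>) (e1 (\<tau> + z)) / qpoch2 (e1 \<tau>) (e1 (\<tau> - z)))"
    unfolding H_def Gam gamma_numerator_def by simp
  have hol: "H holomorphic_on period_cell \<tau>"
    unfolding H_eq Q_def using Gam_nz(1) tau_nonzero[OF tau]
    by (intro holomorphic_intros holomorphic_psi_prod holomorphic_qpoch2_comp norm_e1_tau[OF tau]) auto
  obtain k where k: "\<And>z. z \<in> period_cell \<tau> \<Longrightarrow> H z = k"
  proof (rule periodic_norm_imp_constant[OF tau hol])
    show "norm (H (z + 1)) = norm (H z)" if "z \<in> period_cell \<tau>" for z
      using H_1[OF that] by simp
    show "norm (H (z + \<tau>)) = norm (H z)" if "z \<in> period_cell \<tau>" "z + \<tau> \<in> period_cell \<tau>" for z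
      using H_tau[OF period_cell_shift_nonlattice[OF tau that]] c(1) by (simp add: norm_mult)
  qed (blast intro: that)
  have "gamma_numerator \<tau> 0 = e1 (1 / 24 - 1 / 24)"
    unfolding gamma_numerator_def psi_prod_0[OF tau] by (simp add: Q_tau flip: e1_add)
  then have "H 0 = 1"
    using Gam[of 0] Gam_nz(1)[OF zero_in_period_cell[OF tau]] by (simp add: H_def)
  then have H_cell: "H z = 1" if "z \<in> period_cell \<tau>" for z
    using k[OF that] k[OF zero_in_period_cell[OF tau]] by simp
  \<comment> \<open>the multiplier \<open>c\<close> is now read off from \<open>H = 1\<close> at two points differing by \<open>\<tau>\<close>\<close>
  have "c = 1"
  proof -
    have h: "- \<tau> / 2 \<in> period_cell \<tau>" "- \<tau> / 2 + \<tau> \<in> period_cell \<tau>"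
      using period_cell_iff[OF tau, of 0 "-1/2"] period_cell_iff[OF tau, of 0 "1/2"] by simp_all
    have "- \<tau> / 2 \<notin> period_lattice \<tau>"
      using period_cell_shift_nonlattice[OF tau h] by simp
    then show ?thesis
      using H_tau[of "- \<tau> / 2"] H_cell[OF h(1)] H_cell[OF h(2)] by simp
  qed
  show ?thesis
    using assms
  proof (rule nonlattice_induct[OF tau])
    fix w assume "w \<in> period_cell \<tau>"
    then show "ell_Gamma (w + \<tau>) \<tau> \<tau> = gamma_numerator \<tau> w"
      using H_cell[of w] Gam_nz[of w] Gam[of w] by (simp add: H_def divide_eq_eq split: if_splits)
  next
    fix w assume w: "w \<notin> period_lattice \<tau>"
    show "(ell_Gamma (w + 1 + \<tau>) \<tau> \<tau> = gamma_numerator \<tau> (w + 1)) =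
        (ell_Gamma (w + \<tau>) \<tau> \<tau> = gamma_numerator \<tau> w)"
      using gamma_numerator_add_1[OF nonlattice_psi_dom[OF tau w]] ell_Gamma_add_1[OF tau, of "w + \<tau>"]
      by (simp add: add_ac)
    have w': "w + \<tau> \<notin> period_lattice \<tau>" using w by (simp add: period_lattice_add_tau)
    show "(ell_Gamma (w + \<tau> + \<tau>) \<tau> \<tau> = gamma_numerator \<tau> (w + \<tau>)) =
        (ell_Gamma (w + \<tau>) \<tau> \<tau> = gamma_numerator \<tau> w)"
      unfolding gamma_numerator_add_tau[OF w] c(2)[OF w] ell_Gamma_add_tau[OF tau w'] \<open>c = 1\<close>
      using theta0_nonzero[OF tau w'] by simp
  qed
qed

end

theorem theorem5p2:
  fixes z \<tau> :: complex
  assumes "Im \<tau> > 0"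
    and "z \<notin> {of_int m + of_int n * \<tau> | m n :: int. True}"
  shows "convergent_prod
           (\<lambda>k. psi ((of_nat k + 1 + z) / \<tau>) / psi ((of_nat k - z) / \<tau>)) \<and>
         ell_Gamma z \<tau> \<tau> =
           exp (- (of_real pi * \<i> * Q z \<tau> \<tau>)) / theta0 (z / \<tau>) (- 1 / \<tau>) *
           (\<Prod>k. psi ((of_nat k + 1 + z) / \<tau>) / psi ((of_nat k - z) / \<tau>))"
proof -
  note tau = assms(1)
  have z: "z \<notin> period_lattice \<tau>" using assms(2) by (simp add: period_lattice_def)
  have f: "psi ((of_nat k + 1 + z) / \<tau>) / psi ((of_nat k - z) / \<tau>) = psi_factor \<tau> k z" for k
    by (simp add: psi_factor_def)
  \<comment> \<open>apply the shifted form of the identity at \<open>z - \<tau>\<close>\<close>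
  define w where "w = z - \<tau>"
  have zw: "z = w + \<tau>" by (simp add: w_def)
  then have w: "w \<notin> period_lattice \<tau>" using z by (simp add: period_lattice_add_tau)
  have "z / \<tau> = w / \<tau> + 1" using tau_nonzero[OF tau] by (simp add: zw add_divide_distrib)
  then have th: "theta0 (z / \<tau>) (- 1 / \<tau>) = theta0 (w / \<tau>) (- 1 / \<tau>)"
    by (simp only: theta0_add_1[OF Im_minus_inverse_tau[OF tau]])
  have "z / \<tau> \<notin> period_lattice (- 1 / \<tau>)"
    using z by (simp only: period_lattice_mult_modulus[OF tau_nonzero[OF tau]] not_False_eq_True)
  then have nz: "theta0 (z / \<tau>) (- 1 / \<tau>) \<noteq> 0"
    by (rule theta0_nonzero[OF Im_minus_inverse_tau[OF tau]])
  have "ell_Gamma z \<tau> \<tau> = e1 (- Q z \<tau> \<tau> / 2) * psi_prod \<tau> w"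
    using ell_Gamma_eq_numerator[OF tau w] by (simp add: gamma_numerator_def zw)
  also have "psi_prod \<tau> w = psi_prod \<tau> z / theta0 (z / \<tau>) (- 1 / \<tau>)"
  proof -
    have p: "psi_prod \<tau> z = psi_prod \<tau> w * theta0 (z / \<tau>) (- 1 / \<tau>)"
      using psi_prod_add_tau[OF tau w] unfolding zw [symmetric] th .
    show ?thesis
      unfolding p using nz by (rule nonzero_mult_div_cancel_right [symmetric])
  qed
  also have "e1 (- Q z \<tau> \<tau> / 2) = exp (- (of_real pi * \<i> * Q z \<tau> \<tau>))"
    by (simp add: e1_def mult_ac)
  finally show ?thesis
    using convergent_prod_psi_factor[OF tau] unfolding f by (simp add: psi_prod_def)
qed

end
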